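(* Consider a non-degenerate Euclidean tetrahedron in $\mathbb{R}^3$ with edge lengths $l=(l_{ij})_{1\le i<j\le 4}$, volume $V$, face areas $S_1,\dots,S_4$ and exterior dihedral angles $\theta_{ij}\in(0,\pi)$. Let $|l|^2=\sum_{i<j}l_{ij}^2$, let $\rho=-\frac{2^2\prod_iS_i^2}{3^5V^5|l|}$, and let $\mathcal{H}$ be the $7\times7$ matrix $$ \mathcal{H}=-i|l|\begin{pmatrix}0&\frac{\partial\det\tilde G}{\partial\theta_{ij}}\\ \frac{\partial\det\tilde G}{\partial\theta_{km}}&\rho\,\frac{\partial^2\det\tilde G}{\partial\theta_{ij}\partial\theta_{km}}\end{pmatrix} $$ evaluated at the dihedral angles of the tetrahedron (it is the Hessian, with respect to $(\rho,\theta)$, of $i\big(\sum_{i<j}l_{ij}\theta_{ij}-|l|\rho\det\tilde G(\theta)\big)$ at its stationary point). Then $\mathcal{H}$ is invertible and $$ \det(-\mathcal{H}^{-1})=-i\,\frac{1}{2\cdot 3^7}\,\frac{\prod_{i=1}^4S_i^2}{|l|^2\,V^7}. $$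
   Context: The faces of the tetrahedron are labelled $1,\dots,4$; $ij$ labels the edge shared by faces $i$ and $j$, with length $l_{ij}=l_{ji}$; $\theta_{ij}$ is the exterior dihedral angle at this edge, i.e. the angle between the outward normals of faces $i$ and $j$. $\tilde G=\tilde G(\theta)$ is the $4\times4$ angle Gram matrix $\tilde G_{ij}=\cos\theta_{ij}$ with $\theta_{ii}=0$, $\theta_{ij}=\theta_{ji}$; $\det\tilde G$ is regarded as a function of six independent variables $\theta_{ij}$, $i<j$, and the partial derivatives are taken in this sense. The index pairs $(ij)$, $i<j$, and $(km)$, $k<m$, label the last six rows/columns of $\mathcal H$. *)

theory Defs
  imports "HOL-Analysis.Analysis"
begin

text \<open>
  Faces are labelled by the four-element type \<^typ>\<open>4\<close>, whose arithmetic is modulo 4, so the label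
  4 is 0. A tetrahedron is given by its vertices, vertex \<open>p i\<close> being the one opposite to face \<open>i\<close>.
  In particular the edge \<open>ij\<close> is the one shared by the faces \<open>i\<close> and \<open>j\<close>, and joins the two
  vertices with labels other than \<open>i\<close> and \<open>j\<close>.
\<close>

typedef edge = "{(i, j). i < (j :: 4)}"
  by (rule exI[of _ "(0, 1)"]) (simp add: less_bit0_def bit0.Rep_0 bit0.Rep_1)

instance edge :: finite
proof
  have "finite (range Rep_edge)" by (rule finite_subset[OF subset_UNIV]) simp
  then show "finite (UNIV :: edge set)"
    by (rule finite_imageD) (simp add: inj_on_def Rep_edge_inject)
qed

definition edge_fst :: "edge \<Rightarrow> 4" where
  "edge_fst e = fst (Rep_edge e)"

definition edge_snd :: "edge \<Rightarrow> 4" where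
  "edge_snd e = snd (Rep_edge e)"

text \<open>Only meaningful for distinct arguments.\<close>

definition edge_between :: "4 \<Rightarrow> 4 \<Rightarrow> edge" where
  "edge_between i j = Abs_edge (min i j, max i j)"

definition nondegenerate :: "(4 \<Rightarrow> real^3) \<Rightarrow> bool" where
  "nondegenerate p \<longleftrightarrow> inj p \<and> \<not> affine_dependent (range p)"

definition face :: "(4 \<Rightarrow> real^3) \<Rightarrow> 4 \<Rightarrow> (real^3) set" where
  "face p i = convex hull (p ` (- {i}))"

definition tetra_volume :: "(4 \<Rightarrow> real^3) \<Rightarrow> real" where
  "tetra_volume p = measure lborel (convex hull (range p))"

definition triangle_area :: "real^3 \<Rightarrow> real^3 \<Rightarrow> real^3 \<Rightarrow> real" where
  "triangle_area a b c = norm (cross3 (b - a) (c - a)) / 2"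

text \<open>Modulo 4, the labels other than \<open>i\<close> are \<open>i + 1\<close>, \<open>i + 2\<close> and \<open>i + 3\<close>.\<close>

definition face_area :: "(4 \<Rightarrow> real^3) \<Rightarrow> 4 \<Rightarrow> real" where
  "face_area p i = triangle_area (p (i + 1)) (p (i + 2)) (p (i + 3))"

text \<open>The shared edge is a segment, so its diameter is its length.\<close>

definition edge_length :: "(4 \<Rightarrow> real^3) \<Rightarrow> 4 \<Rightarrow> 4 \<Rightarrow> real" where
  "edge_length p i j = diameter (face p i \<inter> face p j)"

definition outward_normal :: "(4 \<Rightarrow> real^3) \<Rightarrow> 4 \<Rightarrow> real^3" where
  "outward_normal p i =
     (THE n. norm n = 1 \<and>
             (\<forall>x\<in>face p i. \<forall>y\<in>face p i. n \<bullet> (x - y) = 0) \<and>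
             (\<forall>x\<in>face p i. n \<bullet> (p i - x) < 0))"

definition dihedral_angle :: "(4 \<Rightarrow> real^3) \<Rightarrow> 4 \<Rightarrow> 4 \<Rightarrow> real" where
  "dihedral_angle p i j = arccos (outward_normal p i \<bullet> outward_normal p j)"

definition lengths :: "(4 \<Rightarrow> real^3) \<Rightarrow> real^edge" where
  "lengths p = (\<chi> e. edge_length p (edge_fst e) (edge_snd e))"

definition angles :: "(4 \<Rightarrow> real^3) \<Rightarrow> real^edge" where
  "angles p = (\<chi> e. dihedral_angle p (edge_fst e) (edge_snd e))"

definition gram :: "real^edge \<Rightarrow> real^4^4" where
  "gram \<theta> = (\<chi> i j. cos (if i = j then 0 else \<theta> $ edge_between i j))"

definition det_gram :: "real^edge \<Rightarrow> real" where
  "det_gram \<theta> = det (gram \<theta>)"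

definition partial :: "'n \<Rightarrow> (real^'n \<Rightarrow> 'b) \<Rightarrow> real^'n::finite \<Rightarrow> 'b::real_normed_vector" where
  "partial k f x = vector_derivative (\<lambda>t. f (x + t *\<^sub>R axis k 1)) (at 0)"

definition rho :: "(4 \<Rightarrow> real^3) \<Rightarrow> real" where
  "rho p = - (2^2 * (\<Prod>i\<in>UNIV. (face_area p i)^2)) / (3^5 * (tetra_volume p)^5 * norm (lengths p))"

text \<open>
  Index \<^term>\<open>None\<close> is the first row or column of the \<open>7 \<times> 7\<close> matrix (the variable \<open>\<rho>\<close>),
  and the indices \<open>Some e\<close> are the last six (the variables \<open>\<theta>\<close>).
\<close>

definition H_matrix :: "(4 \<Rightarrow> real^3) \<Rightarrow> complex^(edge option)^(edge option)" where
  "H_matrix p = (\<chi> a b. - \<i> * complex_of_real (norm (lengths p)) * complex_of_real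
     (case (a, b) of
        (None, None) \<Rightarrow> 0
      | (None, Some e) \<Rightarrow> partial e det_gram (angles p)
      | (Some e, None) \<Rightarrow> partial e det_gram (angles p)
      | (Some e, Some e') \<Rightarrow> rho p * partial e (partial e' det_gram) (angles p)))"

definition action :: "(4 \<Rightarrow> real^3) \<Rightarrow> real^(edge option) \<Rightarrow> complex" where
  "action p x = \<i> * complex_of_real
     ((\<Sum>e\<in>UNIV. lengths p $ e * x $ Some e)
      - norm (lengths p) * x $ None * det_gram (\<chi> e. x $ Some e))"

definition stationary_point :: "(4 \<Rightarrow> real^3) \<Rightarrow> real^(edge option)" where
  "stationary_point p = (\<chi> a. case a of None \<Rightarrow> rho p | Some e \<Rightarrow> angles p $ e)"

end

theory Submission
  imports Defs
begin

text \<open>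
  Let \<open>m i\<close> be the normal vector of face \<open>i\<close> whose norm is twice the area, and \<open>A i j = m i \<bullet> m j\<close>.
  The \<open>m i\<close> add up to 0, so \<open>A\<close> is a weighted Laplacian: it is determined by its six off-diagonal
  entries \<open>a e\<close>, and all its cofactors equal one number \<open>\<alpha>\<close>. With \<open>t i = A i i\<close> and, for \<open>e = ij\<close>,
  \<open>b e = t i * t j - (a e)\<^sup>2\<close>, elementary vector algebra gives \<open>cos (\<theta> e) = a e / sqrt (t i * t j)\<close>,
  \<open>b e = (6 * V * l e)\<^sup>2\<close> and \<open>\<alpha> = (6 * V)^4\<close>. This yields stationarity, and shows that rescaling rows
  and columns by the edge lengths turns the Hessian into the matrix \<open>Q - 2 * \<alpha> * diag (a / b)\<close> bordered
  by ones, where \<open>Q\<close> is the second derivative at \<open>A\<close> of \<open>det\<close> on symmetric matrices.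

  Modulo the border, \<open>Q = - 2 * \<alpha> * J A\<^sup>+ J\<^sup>T\<close> with \<open>J\<close> the edge-vertex incidence matrix. So the bordered
  matrix is a Schur complement in the \<open>10 \<times> 10\<close> matrix with blocks \<open>diag (a / b)\<close>, \<open>J\<close>, \<open>J\<^sup>T\<close>, \<open>- A\<close>.
  Since \<open>A = J\<^sup>T diag a J + 2 * diag t\<close>, clearing denominators there leaves the blocks \<open>diag a\<close>,
  \<open>diag (t i * t j) J\<close>, \<open>J\<^sup>T\<close>, \<open>- 2 * diag t\<close>, and this determinant is \<open>4 * \<alpha>\<^sup>2 * (\<Prod>i. t i)\<close>: for
  nonzero \<open>a e\<close> by eliminating the first block, and in general by continuity.
\<close>

section \<open>Block determinants\<close>

text \<open>In the Leibniz expansion, a permutation that moves some \<open>k\<close> outside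
  \<open>range f\<close> meets a zero entry of the unit column \<open>k\<close>. Only permutations
  of \<open>range f\<close> survive, and conjugating them with \<open>f\<close> preserves their
  sign.\<close>

lemma det_embed_unit_columns:
  fixes A :: "'a::comm_ring_1^'n^'n" and f :: "'m::finite \<Rightarrow> 'n"
  assumes inj: "inj f"
    and unit: "\<And>i k. k \<notin> range f \<Longrightarrow> A $ i $ k = (if i = k then 1 else 0)"
  shows "det A = det (\<chi> i j. A $ f i $ f j)"
proof -
  define P where "P \<sigma> = (\<Prod>i\<in>UNIV. A $ i $ \<sigma> i)" for \<sigma>
  have bij: "bij_betw f UNIV (range f)"
    using inj by (simp add: bij_betw_def)
  have "det A = (\<Sum>\<sigma> | \<sigma> permutes UNIV. of_int (sign \<sigma>) * P \<sigma>)"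
    by (simp add: det_def P_def)
  also have "\<dots> = (\<Sum>\<sigma> | \<sigma> permutes range f. of_int (sign \<sigma>) * P \<sigma>)"
  proof (rule sum.mono_neutral_right)
    show "\<forall>\<sigma>\<in>{\<sigma>. \<sigma> permutes UNIV} - {\<sigma>. \<sigma> permutes range f}. of_int (sign \<sigma>) * P \<sigma> = 0"
    proof
      fix \<sigma> assume "\<sigma> \<in> {\<sigma>. \<sigma> permutes (UNIV::'n set)} - {\<sigma>. \<sigma> permutes range f}"
      then have \<sigma>: "\<sigma> permutes UNIV" "\<not> \<sigma> permutes range f" by auto
      then obtain k where k: "k \<notin> range f" "\<sigma> k \<noteq> k"
        unfolding permutes_def by blast
      obtain i where i: "\<sigma> i = k" using \<sigma>(1) by (metis permutes_def)
      then have "i \<noteq> k" using k by auto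
      then have "A $ i $ \<sigma> i = 0" using i k unit by auto
      then have "P \<sigma> = 0" unfolding P_def by (intro prod_zero) auto
      then show "of_int (sign \<sigma>) * P \<sigma> = 0" by simp
    qed
  qed (auto intro: permutes_subset)
  also have "\<dots> = (\<Sum>\<pi> | \<pi> permutes UNIV. of_int (sign \<pi>) * (\<Prod>i\<in>UNIV. A $ f i $ f (\<pi> i)))"
  proof (rule sum.reindex_bij_witness[where i = "map_permutation UNIV f" and j = "map_permutation (range f) (inv f)"])
    fix \<sigma> assume "\<sigma> \<in> {\<sigma>. \<sigma> permutes range f}"
    then have \<sigma>: "\<sigma> permutes range f" by simp
    have bij': "bij_betw (inv f) (range f) UNIV"
      using inj by (simp add: bij_betw_def inj_on_inv_into image_image)
    show 1: "map_permutation UNIV f (map_permutation (range f) (inv f) \<sigma>) = \<sigma>"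
      by (rule map_permutation_compose_inv[OF bij' \<sigma>]) (auto simp: f_inv_into_f inj)
    have 2: "map_permutation (range f) (inv f) \<sigma> permutes UNIV"
      by (rule map_permutation_permutes[OF bij' \<sigma>])
    then show "map_permutation (range f) (inv f) \<sigma> \<in> {\<pi>. \<pi> permutes UNIV}" by simp
    let ?\<pi> = "map_permutation (range f) (inv f) \<sigma>"
    have s: "sign ?\<pi> = sign \<sigma>"
      by (rule sign_map_permutation) (auto intro: inj_on_inv_into \<sigma>)
    have ap: "f (?\<pi> i) = \<sigma> (f i)" for i
      using map_permutation_apply[OF inj, of i ?\<pi>] 1 by simp
    \<comment> \<open>\<open>\<sigma>\<close> fixes every index outside \<open>range f\<close>,
      where the diagonal entry is 1.\<close>
    have "P \<sigma> = (\<Prod>i\<in>range f. A $ i $ \<sigma> i)"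
      unfolding P_def
      by (rule prod.mono_neutral_right) (use \<sigma> unit in \<open>auto simp: permutes_def\<close>)
    also have "\<dots> = (\<Prod>i\<in>UNIV. A $ f i $ \<sigma> (f i))"
      by (simp add: prod.reindex inj)
    finally show "of_int (sign ?\<pi>) * (\<Prod>i\<in>UNIV. A $ f i $ f (?\<pi> i)) = of_int (sign \<sigma>) * P \<sigma>"
      by (simp add: s ap)
  next
    fix \<pi> assume "\<pi> \<in> {\<pi>. \<pi> permutes (UNIV::'m set)}"
    then have \<pi>: "\<pi> permutes UNIV" by simp
    show "map_permutation (range f) (inv f) (map_permutation UNIV f \<pi>) = \<pi>"
      by (rule map_permutation_compose_inv[OF bij \<pi>]) (auto simp: inj)
    show "map_permutation UNIV f \<pi> \<in> {\<sigma>. \<sigma> permutes range f}"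
      using map_permutation_permutes[OF bij \<pi>] by simp
  qed
  also have "\<dots> = det (\<chi> i j. A $ f i $ f j)"
    by (simp add: det_def)
  finally show ?thesis .
qed

lemma sum_mult_unit_vector:
  fixes h :: "'n::finite \<Rightarrow> 'a::semiring_1"
  shows "(\<Sum>j\<in>UNIV. (if i = j then 1 else 0) * h j) = h i"
    and "(\<Sum>j\<in>UNIV. (if j = i then 1 else 0) * h j) = h i"
    and "(\<Sum>j\<in>UNIV. h j * (if i = j then 1 else 0)) = h i"
    and "(\<Sum>j\<in>UNIV. h j * (if j = i then 1 else 0)) = h i"
proof -
  have "(if b then 1 else 0) * x = (if b then x else 0)" "x * (if b then 1 else 0) = (if b then x else 0)"
    for b and x :: 'a by auto
  then show "(\<Sum>j\<in>UNIV. (if i = j then 1 else 0) * h j) = h i"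
    "(\<Sum>j\<in>UNIV. (if j = i then 1 else 0) * h j) = h i"
    "(\<Sum>j\<in>UNIV. h j * (if i = j then 1 else 0)) = h i"
    "(\<Sum>j\<in>UNIV. h j * (if j = i then 1 else 0)) = h i"
    by simp_all
qed

lemma sum_split_injections:
  fixes f :: "'m::finite \<Rightarrow> 'n::finite" and g :: "'k::finite \<Rightarrow> 'n"
  assumes "inj f" "inj g" "range f \<inter> range g = {}" "range f \<union> range g = UNIV"
  shows "(\<Sum>i\<in>UNIV. h i) = (\<Sum>i\<in>UNIV. h (f i)) + (\<Sum>i\<in>UNIV. h (g i))"
proof -
  have "(\<Sum>i\<in>UNIV. h i) = (\<Sum>i\<in>range f. h i) + (\<Sum>i\<in>range g. h i)"
    unfolding assms(4)[symmetric] by (rule sum.union_disjoint) (use assms in auto)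
  then show ?thesis using assms by (simp add: sum.reindex)
qed

text \<open>Blockwise, \<open>(F, 0; C, G) = (F, 0; C, 1) (1, 0; 0, G)\<close>. Each factor has unit
  columns on one of the two index ranges, so its determinant is that of a single diagonal
  block.\<close>

lemma det_block_lower_triangular:
  fixes A :: "'a::comm_ring_1^'n^'n" and f :: "'m::finite \<Rightarrow> 'n" and g :: "'k::finite \<Rightarrow> 'n"
  assumes fg: "inj f" "inj g" "range f \<inter> range g = {}" "range f \<union> range g = UNIV"
    and zero: "\<And>i j. A $ f i $ g j = 0"
  shows "det A = det (\<chi> i j. A $ f i $ f j) * det (\<chi> i j. A $ g i $ g j)"
proof -
  define L where "L = (\<chi> i k. if k \<in> range g then if i = k then 1 else 0 else A $ i $ k)"
  define R where "R = (\<chi> i k. if k \<in> range f then if i = k then 1 else 0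
                                 else if i \<in> range f then 0 else A $ i $ k)"
  have [simp]: "f i \<noteq> g j" "g j \<noteq> f i" for i j using fg(3) by auto
  have [simp]: "f i = f j \<longleftrightarrow> i = j" "g k = g l \<longleftrightarrow> k = l" for i j k l
    using fg by (auto dest: injD)
  have [simp]: "f i \<notin> range g" "g j \<notin> range f" for i j using fg(3) by auto
  have cases: "(\<exists>j. i = f j) \<or> (\<exists>j. i = g j)" for i using fg(4) by blast
  have "A = L ** R"
  proof (vector, intro allI)
    fix i k
    have "(L ** R) $ i $ k = (\<Sum>j\<in>UNIV. L $ i $ f j * R $ f j $ k) + (\<Sum>j\<in>UNIV. L $ i $ g j * R $ g j $ k)"
      unfolding matrix_matrix_mult_def by (simp add: sum_split_injections[OF fg])
    also have "\<dots> = A $ i $ k"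
      using cases[of i] cases[of k]
      by (auto simp: L_def R_def zero sum_mult_unit_vector)
    finally show "A $ i $ k = (L ** R) $ i $ k" by simp
  qed
  then have "det A = det L * det R" by (simp add: det_mul)
  also have "det L = det (\<chi> i j. L $ f i $ f j)"
    by (rule det_embed_unit_columns[OF fg(1)]) (use fg(4) in \<open>auto simp: L_def\<close>)
  also have "(\<chi> i j. L $ f i $ f j) = (\<chi> i j. A $ f i $ f j)" by (simp add: L_def)
  also have "det R = det (\<chi> i j. R $ g i $ g j)"
    by (rule det_embed_unit_columns[OF fg(2)]) (use fg(4) in \<open>auto simp: R_def\<close>)
  also have "(\<chi> i j. R $ g i $ g j) = (\<chi> i j. A $ g i $ g j)" by (simp add: R_def)
  finally show ?thesis .
qed

text \<open>Block Gaussian elimination: a row operation of determinant 1 clears the block with rows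
  in \<open>f\<close> and columns in \<open>g\<close>, and leaves a block triangular matrix.\<close>

lemma det_Schur:
  fixes A :: "'a::comm_ring_1^'n^'n" and f :: "'m::finite \<Rightarrow> 'n" and g :: "'k::finite \<Rightarrow> 'n"
    and T' :: "'a^'k^'k"
  assumes fg: "inj f" "inj g" "range f \<inter> range g = {}" "range f \<union> range g = UNIV"
    and inv: "T' ** (\<chi> i j. A $ g i $ g j) = mat 1"
  shows "det A = det (\<chi> i j. A $ g i $ g j) *
    det (\<chi> i j. A $ f i $ f j - (\<Sum>k\<in>UNIV. \<Sum>l\<in>UNIV. A $ f i $ g k * T' $ k $ l * A $ g l $ f j))"
proof -
  have [simp]: "f i \<noteq> g j" "g j \<noteq> f i" for i j using fg(3) by auto
  have [simp]: "f i = f j \<longleftrightarrow> i = j" "g k = g l \<longleftrightarrow> k = l" for i j k l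
    using fg by (auto dest: injD)
  have [simp]: "f i \<notin> range g" "g j \<notin> range f" for i j using fg(3) by auto
  have [simp]: "inv g (g k) = k" "inv f (f i) = i" for k i using fg by simp_all
  have cases: "(\<exists>j. i = f j) \<or> (\<exists>j. i = g j)" for i using fg(4) by blast
  \<comment> \<open>In block form \<open>U = (1, - A_fg T'; 0, 1)\<close>. The index of
    \<open>T'\<close> belonging to column \<open>k\<close> is recovered as
    \<open>inv g k\<close>.\<close>
  define U where "U = (\<chi> i k. if i = k then 1 else if i \<in> range f \<and> k \<in> range g
      then - (\<Sum>l\<in>UNIV. A $ i $ g l * T' $ l $ inv g k) else 0)"
  have invD: "(\<Sum>l\<in>UNIV. T' $ k $ l * A $ g l $ g m) = (if k = m then 1 else 0)" for k m
    using arg_cong[OF inv, of "\<lambda>M. M $ k $ m"] by (simp add: matrix_matrix_mult_def mat_def)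
  have U_entries: "U $ f i $ f j = (if i = j then 1 else 0)" "U $ g k $ g l = (if k = l then 1 else 0)"
      "U $ g k $ f j = 0" "U $ f i $ g k = - (\<Sum>l\<in>UNIV. A $ f i $ g l * T' $ l $ k)" for i j k l
    by (auto simp: U_def)
  have entry_f: "(U ** A) $ f i $ k = A $ f i $ k - (\<Sum>m\<in>UNIV. \<Sum>l\<in>UNIV. A $ f i $ g m * T' $ m $ l * A $ g l $ k)" for i k
  proof -
    have "(U ** A) $ f i $ k = (\<Sum>j\<in>UNIV. U $ f i $ f j * A $ f j $ k) + (\<Sum>j\<in>UNIV. U $ f i $ g j * A $ g j $ k)"
      unfolding matrix_matrix_mult_def by (simp add: sum_split_injections[OF fg])
    also have "(\<Sum>j\<in>UNIV. U $ f i $ f j * A $ f j $ k) = A $ f i $ k"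
      by (simp add: U_entries sum_mult_unit_vector)
    also have "(\<Sum>j\<in>UNIV. U $ f i $ g j * A $ g j $ k) = - (\<Sum>l\<in>UNIV. \<Sum>m\<in>UNIV. A $ f i $ g m * T' $ m $ l * A $ g l $ k)"
      by (simp add: U_entries sum_distrib_right sum_negf)
    finally show ?thesis by (subst sum.swap) simp
  qed
  have entry_g: "(U ** A) $ g i $ k = A $ g i $ k" for i k
    unfolding matrix_matrix_mult_def
    by (simp add: sum_split_injections[OF fg] U_entries sum_mult_unit_vector)
  have zero: "(U ** A) $ f i $ g j = 0" for i j
  proof -
    have "(\<Sum>m\<in>UNIV. \<Sum>l\<in>UNIV. A $ f i $ g m * T' $ m $ l * A $ g l $ g j)
        = (\<Sum>m\<in>UNIV. A $ f i $ g m * (\<Sum>l\<in>UNIV. T' $ m $ l * A $ g l $ g j))"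
      by (simp add: sum_distrib_left mult.assoc)
    also have "\<dots> = A $ f i $ g j" by (simp add: invD sum_mult_unit_vector)
    finally show ?thesis by (simp add: entry_f)
  qed
  have "det U = det (\<chi> i j. U $ g i $ g j) * det (\<chi> i j. U $ f i $ f j)"
    by (rule det_block_lower_triangular) (use fg in \<open>auto simp: U_entries\<close>)
  also have "\<dots> = 1"
    using det_I[where 'a='a and 'n='k] det_I[where 'a='a and 'n='m]
    by (simp add: U_entries mat_def)
  finally have "det A = det (U ** A)" by (simp add: det_mul)
  also have "\<dots> = det (\<chi> i j. (U ** A) $ f i $ f j) * det (\<chi> i j. (U ** A) $ g i $ g j)"
    by (rule det_block_lower_triangular[OF fg zero])
  finally show ?thesis by (simp add: entry_f entry_g mult.commute)
qed

lemma UNIV_label: "(UNIV :: 4 set) = {0, 1, 2, 3}"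
proof -
  have "(4::4) = 0" by simp
  then show ?thesis unfolding UNIV_4 by (simp only:) blast
qed

lemma det_4:
  "det (A::'a::comm_ring_1^4^4) =
     A$0$0 * (A$1$1 * (A$2$2 * A$3$3 - A$2$3 * A$3$2) - A$1$2 * (A$2$1 * A$3$3 - A$2$3 * A$3$1)
            + A$1$3 * (A$2$1 * A$3$2 - A$2$2 * A$3$1))
   - A$0$1 * (A$1$0 * (A$2$2 * A$3$3 - A$2$3 * A$3$2) - A$1$2 * (A$2$0 * A$3$3 - A$2$3 * A$3$0)
            + A$1$3 * (A$2$0 * A$3$2 - A$2$2 * A$3$0))
   + A$0$2 * (A$1$0 * (A$2$1 * A$3$3 - A$2$3 * A$3$1) - A$1$1 * (A$2$0 * A$3$3 - A$2$3 * A$3$0)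
            + A$1$3 * (A$2$0 * A$3$1 - A$2$1 * A$3$0))
   - A$0$3 * (A$1$0 * (A$2$1 * A$3$2 - A$2$2 * A$3$1) - A$1$1 * (A$2$0 * A$3$2 - A$2$2 * A$3$0)
            + A$1$2 * (A$2$0 * A$3$1 - A$2$1 * A$3$0))"
proof -
  have f0: "finite {1::4, 2, 3}" "0 \<notin> {1::4, 2, 3}" by auto
  have f1: "finite {2::4, 3}" "1 \<notin> {2::4, 3}" by auto
  have f2: "finite {3::4}" "2 \<notin> {3::4}" by auto
  show ?thesis
    unfolding det_def UNIV_label
    unfolding sum_over_permutations_insert[OF f0]
    unfolding sum_over_permutations_insert[OF f1]
    unfolding sum_over_permutations_insert[OF f2]
    unfolding permutes_sing
    by (simp add: sign_swap_id permutation_swap_id permutation_compose sign_compose sign_id swap_id_eq algebra_simps)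
qed

section \<open>Edges of the tetrahedron and Laplacians\<close>

lemma label_cases: "i = 0 \<or> i = 1 \<or> i = 2 \<or> i = (3::4)"
  using UNIV_label by auto

lemma sum_label: "sum f (UNIV::4 set) = f 0 + f 1 + f 2 + f 3"
  unfolding UNIV_label by (simp add: ac_simps)

lemma prod_label: "prod f (UNIV::4 set) = f 0 * f 1 * f 2 * f 3"
  unfolding UNIV_label by (simp add: ac_simps)

lemma label_less: "(0::4) < 1" "(0::4) < 2" "(0::4) < 3" "(1::4) < 2" "(1::4) < 3" "(2::4) < 3"
  by (simp_all add: less_bit0_def bit0.Rep_0 bit0.Rep_1 bit0.Rep_numeral)

lemma edge_between_sym: "edge_between i j = edge_between j i"
  by (simp add: edge_between_def min.commute max.commute)

lemma edge_endpoints: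
  assumes "i < j"
  shows "edge_fst (edge_between i j) = i" "edge_snd (edge_between i j) = j"
  using assms by (simp_all add: edge_fst_def edge_snd_def edge_between_def Abs_edge_inverse)

lemma edge_between_endpoints: "edge_between (edge_fst e) (edge_snd e) = e"
  and edge_fst_less_snd: "edge_fst e < edge_snd e"
proof -
  have "Rep_edge e \<in> {(i, j). i < j}" by (rule Rep_edge)
  then show "edge_fst e < edge_snd e" by (auto simp: edge_fst_def edge_snd_def)
  then show "edge_between (edge_fst e) (edge_snd e) = e"
    by (simp add: edge_between_def edge_fst_def edge_snd_def Rep_edge_inverse)
qed

lemmas label_edge_endpoints [simp] = label_less[THEN edge_endpoints(1)] label_less[THEN edge_endpoints(2)]

lemma label_edge_swap [simp]:
  "edge_between 1 0 = edge_between 0 1" "edge_between 2 0 = edge_between 0 2"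
  "edge_between 3 0 = edge_between 0 3" "edge_between 2 1 = edge_between 1 2"
  "edge_between 3 1 = edge_between 1 3" "edge_between 3 2 = edge_between 2 3"
  by (simp_all add: edge_between_sym)

lemma edge_eq_iff: "e = f \<longleftrightarrow> edge_fst e = edge_fst f \<and> edge_snd e = edge_snd f"
  by (metis edge_between_endpoints)

lemma label_edge_distinct [simp]:
  "edge_between 0 1 \<noteq> edge_between 0 2" "edge_between 0 1 \<noteq> edge_between 0 3"
  "edge_between 0 1 \<noteq> edge_between 1 2" "edge_between 0 1 \<noteq> edge_between 1 3"
  "edge_between 0 1 \<noteq> edge_between 2 3" "edge_between 0 2 \<noteq> edge_between 0 3"
  "edge_between 0 2 \<noteq> edge_between 1 2" "edge_between 0 2 \<noteq> edge_between 1 3"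
  "edge_between 0 2 \<noteq> edge_between 2 3" "edge_between 0 3 \<noteq> edge_between 1 2"
  "edge_between 0 3 \<noteq> edge_between 1 3" "edge_between 0 3 \<noteq> edge_between 2 3"
  "edge_between 1 2 \<noteq> edge_between 1 3" "edge_between 1 2 \<noteq> edge_between 2 3"
  "edge_between 1 3 \<noteq> edge_between 2 3"
  by (simp_all add: edge_eq_iff)

lemmas label_edge_distinct' [simp] = label_edge_distinct[symmetric]

lemma edge_cases:
  "e = edge_between 0 1 \<or> e = edge_between 0 2 \<or> e = edge_between 0 3 \<or>
   e = edge_between 1 2 \<or> e = edge_between 1 3 \<or> e = edge_between 2 3"
proof -
  have not_less: "\<not> 1 < (0::4)" "\<not> 2 < (0::4)" "\<not> 3 < (0::4)" "\<not> 2 < (1::4)" "\<not> 3 < (1::4)" "\<not> 3 < (2::4)"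
    using label_less by auto
  obtain i j where e: "e = edge_between i j" and less: "i < j"
    using edge_between_endpoints[of e] edge_fst_less_snd[of e] by metis
  from label_cases[of i] label_cases[of j] less show ?thesis
    unfolding e by (elim disjE) (simp_all only: not_less less_irrefl simp_thms)
qed

lemma UNIV_edge: "UNIV = {edge_between 0 1, edge_between 0 2, edge_between 0 3,
    edge_between 1 2, edge_between 1 3, edge_between 2 3}"
  using edge_cases by auto

lemma sum_edge: "sum f (UNIV :: edge set) = f (edge_between 0 1) + f (edge_between 0 2) +
    f (edge_between 0 3) + f (edge_between 1 2) + f (edge_between 1 3) + f (edge_between 2 3)"
  unfolding UNIV_edge by (simp add: ac_simps)

lemma prod_edge: "prod f (UNIV :: edge set) = f (edge_between 0 1) * f (edge_between 0 2) *
    f (edge_between 0 3) * f (edge_between 1 2) * f (edge_between 1 3) * f (edge_between 2 3)"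
  unfolding UNIV_edge by (simp add: ac_simps)

section \<open>Weighted Laplacians of the complete graph on the four labels\<close>

definition incidence :: "edge \<Rightarrow> 4 \<Rightarrow> real" where
  "incidence e i = (if i = edge_fst e \<or> i = edge_snd e then 1 else 0)"

text \<open>The weights \<open>a\<close> are the off-diagonal entries themselves, so in the usual
  sign convention for graph Laplacians the conductances are \<open>- a e\<close>. The diagonal is
  chosen to make the row sums vanish.\<close>

definition laplacian :: "(edge \<Rightarrow> real) \<Rightarrow> 4 \<Rightarrow> 4 \<Rightarrow> real" where
  "laplacian a i j = (if i = j then - (\<Sum>e\<in>UNIV. incidence e i * a e) else a (edge_between i j))"

definition edge_minor :: "(edge \<Rightarrow> real) \<Rightarrow> edge \<Rightarrow> real" where
  "edge_minor a e = laplacian a (edge_fst e) (edge_fst e) * laplacian a (edge_snd e) (edge_snd e) - (a e)\<^sup>2"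

text \<open>By the matrix-tree theorem all principal \<open>3 \<times> 3\<close> minors of a Laplacian agree.\<close>

definition tree_minor :: "(edge \<Rightarrow> real) \<Rightarrow> real" where
  "tree_minor a = det (\<chi> i j :: 3. laplacian a (if i = 1 then 1 else if i = 2 then 2 else 3)
                                      (if j = 1 then 1 else if j = 2 then 2 else 3))"

definition block_matrix :: "('m::finite \<Rightarrow> 'm \<Rightarrow> 'a) \<Rightarrow> ('m \<Rightarrow> 'k \<Rightarrow> 'a) \<Rightarrow> ('k \<Rightarrow> 'm \<Rightarrow> 'a) \<Rightarrow>
    ('k \<Rightarrow> 'k \<Rightarrow> 'a) \<Rightarrow> 'a^('m + 'k::finite)^('m + 'k)" where
  "block_matrix P R S T = (\<chi> p q. case p of
     Inl i \<Rightarrow> (case q of Inl j \<Rightarrow> P i j | Inr j \<Rightarrow> R i j)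
   | Inr i \<Rightarrow> (case q of Inl j \<Rightarrow> S i j | Inr j \<Rightarrow> T i j))"

lemma block_matrix_nth [simp]:
  "block_matrix P R S T $ Inl i $ Inl j = P i j"
  "block_matrix P R S T $ Inl i $ Inr l = R i l"
  "block_matrix P R S T $ Inr k $ Inl j = S k j"
  "block_matrix P R S T $ Inr k $ Inr l = T k l"
  by (simp_all add: block_matrix_def)

text \<open>Its entries are polynomial in \<open>a\<close>, so the determinant can be computed for
  nonzero weights first and then extended by continuity.\<close>

definition cleared_matrix :: "(edge \<Rightarrow> real) \<Rightarrow> real^(edge + 4)^(edge + 4)" where
  "cleared_matrix a = block_matrix (\<lambda>e f. if e = f then a e else 0)
     (\<lambda>e i. laplacian a (edge_fst e) (edge_fst e) * laplacian a (edge_snd e) (edge_snd e) * incidence e i)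
     (\<lambda>i e. incidence e i)
     (\<lambda>i j. if i = j then - 2 * laplacian a i i else 0)"

lemma label_edge_incidence [simp]:
 "incidence (edge_between 0 1) i = (if i = 0 \<or> i = 1 then 1 else 0)"
 "incidence (edge_between 0 2) i = (if i = 0 \<or> i = 2 then 1 else 0)"
 "incidence (edge_between 0 3) i = (if i = 0 \<or> i = 3 then 1 else 0)"
 "incidence (edge_between 1 2) i = (if i = 1 \<or> i = 2 then 1 else 0)"
 "incidence (edge_between 1 3) i = (if i = 1 \<or> i = 3 then 1 else 0)"
 "incidence (edge_between 2 3) i = (if i = 2 \<or> i = 3 then 1 else 0)"
  by (simp_all add: incidence_def)

lemma laplacian_diagonal:
  "laplacian a 0 0 = - (a (edge_between 0 1) + a (edge_between 0 2) + a (edge_between 0 3))"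
  "laplacian a 1 1 = - (a (edge_between 0 1) + a (edge_between 1 2) + a (edge_between 1 3))"
  "laplacian a 2 2 = - (a (edge_between 0 2) + a (edge_between 1 2) + a (edge_between 2 3))"
  "laplacian a 3 3 = - (a (edge_between 0 3) + a (edge_between 1 3) + a (edge_between 2 3))"
  by (simp_all add: laplacian_def sum_edge)

lemma laplacian_off_diagonal: "i \<noteq> j \<Longrightarrow> laplacian a i j = a (edge_between i j)"
  by (simp add: laplacian_def)

lemma tree_minor_expand:
  fixes a defines "A \<equiv> laplacian a"
  shows "tree_minor a = A 1 1 * A 2 2 * A 3 3 + 2 * a (edge_between 1 2) * a (edge_between 2 3) * a (edge_between 1 3)
    - A 1 1 * (a (edge_between 2 3))\<^sup>2 - A 2 2 * (a (edge_between 1 3))\<^sup>2 - A 3 3 * (a (edge_between 1 2))\<^sup>2"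
  by (simp add: tree_minor_def det_3 A_def laplacian_off_diagonal power2_eq_square algebra_simps)

section \<open>The determinant of the bordered Hessian\<close>

lemma tendsto_det:
  fixes A :: "'b \<Rightarrow> real^'n^'n"
  assumes "\<And>i j. ((\<lambda>x. A x $ i $ j) \<longlongrightarrow> L $ i $ j) F"
  shows "((\<lambda>x. det (A x)) \<longlongrightarrow> det L) F"
  unfolding det_def by (intro tendsto_intros assms)

lemma det_diagonal_lambda:
  "det (\<chi> i j. if i = j then d i else (0::real)) = (\<Prod>i\<in>(UNIV::'n::finite set). d i)"
  by (subst det_diagonal) auto

text \<open>The matrix is the Schur complement of the block \<open>diag a\<close> in
  \<open>cleared_matrix a\<close>, with the factor \<open>- t i\<close> taken out of row
  \<open>i\<close>. Once the denominators \<open>a e\<close> are cleared, the claim is a polynomial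
  identity in six variables.\<close>

lemma spanning_tree_polynomial:
  fixes a :: "edge \<Rightarrow> real"
  assumes "\<And>e. a e \<noteq> 0"
  defines "t i \<equiv> laplacian a i i"
  shows "(\<Prod>e\<in>UNIV. a e) * det (\<chi> i j. if i = j then 2 + (\<Sum>e\<in>UNIV. incidence e i *
       (\<Sum>k\<in>UNIV. (if k = i then 0 else incidence e k * t k)) / a e) else t j / a (edge_between i j)) = 4 * (tree_minor a)\<^sup>2"
proof -
  define x0 x1 x2 x3 x4 x5 where x: "x0 = a (edge_between 0 1)" "x1 = a (edge_between 0 2)" "x2 = a (edge_between 0 3)"
    "x3 = a (edge_between 1 2)" "x4 = a (edge_between 1 3)" "x5 = a (edge_between 2 3)"
  have nz: "x0 \<noteq> 0" "x1 \<noteq> 0" "x2 \<noteq> 0" "x3 \<noteq> 0" "x4 \<noteq> 0" "x5 \<noteq> 0"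
    using assms by (auto simp: x)
  show ?thesis
    by (simp add: det_4 sum_label sum_edge prod_edge tree_minor_expand t_def laplacian_diagonal x[symmetric],
        use nz in \<open>simp add: divide_simps\<close>, algebra)
qed

lemma sum_Inl_Inr:
  fixes h :: "'m::finite + 'k::finite \<Rightarrow> 'a::comm_monoid_add"
  shows "(\<Sum>p\<in>UNIV. h p) = (\<Sum>i\<in>UNIV. h (Inl i)) + (\<Sum>k\<in>UNIV. h (Inr k))"
  by (rule sum_split_injections) (auto simp: UNIV_sum)

lemma det_cleared_matrix_generic:
  assumes nz: "\<And>e. a e \<noteq> 0"
  shows "det (cleared_matrix a) = 4 * (tree_minor a)\<^sup>2 * (\<Prod>i\<in>UNIV. laplacian a i i)"
proof -
  define t where "t i = laplacian a i i" for i
  define Y where "Y i j = (if i = j then 2 + (\<Sum>e\<in>UNIV. incidence e i *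
       (\<Sum>k\<in>UNIV. (if k = i then 0 else incidence e k * t k)) / a e) else t j / a (edge_between i j))" for i j
  let ?A = "cleared_matrix a" and ?T = "\<chi> e f. if e = f then 1 / a e else 0"
  have corner: "(\<chi> e f. ?A $ Inl e $ Inl f) = (\<chi> e f. if e = f then a e else 0)"
    by (simp add: cleared_matrix_def)
  have "det ?A = det (\<chi> e f. ?A $ Inl e $ Inl f) * det (\<chi> i j. ?A $ Inr i $ Inr j -
      (\<Sum>k\<in>UNIV. \<Sum>l\<in>UNIV. ?A $ Inr i $ Inl k * ?T $ k $ l * ?A $ Inl l $ Inr j))"
  proof (rule det_Schur)
    show "?T ** (\<chi> e f. ?A $ Inl e $ Inl f) = mat 1"
      unfolding corner by (vector matrix_matrix_mult_def mat_def) (auto simp: nz if_distrib[of "\<lambda>x. x * _"] cong: if_cong)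
  qed (auto simp: UNIV_sum)
  also have "det (\<chi> e f. ?A $ Inl e $ Inl f) = (\<Prod>e\<in>UNIV. a e)"
    unfolding corner by (rule det_diagonal_lambda)
  also have "(\<chi> i j. ?A $ Inr i $ Inr j -
      (\<Sum>k\<in>UNIV. \<Sum>l\<in>UNIV. ?A $ Inr i $ Inl k * ?T $ k $ l * ?A $ Inl l $ Inr j)) =
      (\<chi> i. (- t i) *s (\<chi> j. Y i j))"
  proof -
    \<comment> \<open>For an edge \<open>ij\<close> the eliminated term is
      \<open>t i * t j / a e\<close>, so \<open>t i\<close> divides the whole row \<open>i\<close>,
      including its diagonal entry, to which each edge at \<open>i\<close> contributes such a
      term.\<close>
    have "?A $ Inr i $ Inr j - (\<Sum>k\<in>UNIV. \<Sum>l\<in>UNIV. ?A $ Inr i $ Inl k * ?T $ k $ l * ?A $ Inl l $ Inr j)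
       = - t i * Y i j" for i j
      using label_cases[of i] label_cases[of j]
      by (elim disjE) (simp_all add: cleared_matrix_def t_def Y_def sum_edge sum_label algebra_simps)
    then show ?thesis by (simp add: vec_eq_iff)
  qed
  also have "det \<dots> = (\<Prod>i\<in>UNIV. - t i) * det (\<chi> i j. Y i j)"
    by (rule det_rows_mul)
  also have "(\<Prod>i\<in>UNIV. - t i) = (\<Prod>i\<in>UNIV. t i)"
    by (simp add: prod_label)
  finally show ?thesis
    using spanning_tree_polynomial[of a, OF nz] unfolding Y_def t_def by (simp add: mult.left_commute)
qed

text \<open>Both sides are continuous in \<open>a\<close>. Adding the same small nonzero
  \<open>\<epsilon>\<close> to all six weights makes every one of them nonzero, and then
  \<open>\<epsilon>\<close> tends to 0.\<close>

lemma det_cleared_matrix: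
  "det (cleared_matrix a) = 4 * (tree_minor a)\<^sup>2 * (\<Prod>i\<in>UNIV. laplacian a i i)"
proof -
  define b where "b \<epsilon> e = a e + \<epsilon>" for \<epsilon> e
  have lap: "((\<lambda>\<epsilon>. laplacian (b \<epsilon>) i j) \<longlongrightarrow> laplacian a i j) (at 0)" for i j
    unfolding laplacian_def b_def by (cases "i = j") (auto intro!: tendsto_eq_intros)
  have b: "((\<lambda>\<epsilon>. b \<epsilon> e) \<longlongrightarrow> a e) (at 0)" for e
    unfolding b_def by (auto intro!: tendsto_eq_intros)
  have 1: "((\<lambda>\<epsilon>. det (cleared_matrix (b \<epsilon>))) \<longlongrightarrow> det (cleared_matrix a)) (at 0)"
  proof (rule tendsto_det)
    fix p q show "((\<lambda>\<epsilon>. cleared_matrix (b \<epsilon>) $ p $ q) \<longlongrightarrow> cleared_matrix a $ p $ q) (at 0)"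
      by (cases p; cases q) (auto simp: cleared_matrix_def intro!: tendsto_intros lap b)
  qed
  have 2: "((\<lambda>\<epsilon>. 4 * (tree_minor (b \<epsilon>))\<^sup>2 * (\<Prod>i\<in>UNIV. laplacian (b \<epsilon>) i i)) \<longlongrightarrow>
      4 * (tree_minor a)\<^sup>2 * (\<Prod>i\<in>UNIV. laplacian a i i)) (at 0)"
    unfolding tree_minor_def by (intro tendsto_intros tendsto_det) (auto intro: lap)
  have "\<forall>\<^sub>F \<epsilon> in at 0. \<forall>e. b \<epsilon> e \<noteq> 0"
  proof (rule eventually_all_finite)
    show "\<forall>\<^sub>F \<epsilon> in at 0. b \<epsilon> e \<noteq> 0" for e
    proof (cases "a e = 0")
      case True then show ?thesis by (simp add: b_def eventually_at_filter)
    qed (use b tendsto_imp_eventually_ne in blast)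
  qed
  then have "\<forall>\<^sub>F \<epsilon> in at 0. det (cleared_matrix (b \<epsilon>)) =
      4 * (tree_minor (b \<epsilon>))\<^sup>2 * (\<Prod>i\<in>UNIV. laplacian (b \<epsilon>) i i)"
    by eventually_elim (rule det_cleared_matrix_generic, blast)
  with 1 have "((\<lambda>\<epsilon>. 4 * (tree_minor (b \<epsilon>))\<^sup>2 * (\<Prod>i\<in>UNIV. laplacian (b \<epsilon>) i i)) \<longlongrightarrow> det (cleared_matrix a)) (at 0)"
    by (rule Lim_transform_eventually)
  with 2 show ?thesis
    using tendsto_unique[OF at_neq_bot] by blast
qed

section \<open>Clearing the denominators \<open>edge_minor a e\<close>\<close>

definition angle_length_matrix :: "(edge \<Rightarrow> real) \<Rightarrow> real^(edge + 4)^(edge + 4)" where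
  "angle_length_matrix a = block_matrix (\<lambda>e f. if e = f then a e / edge_minor a e else 0)
     incidence (\<lambda>i e. incidence e i) (\<lambda>i j. - laplacian a i j)"

text \<open>The factor \<open>L\<close> multiplies edge row \<open>e\<close> by
  \<open>edge_minor a e\<close>. The factor \<open>R\<close>, of determinant 1, adds to each label
  column the edge columns at that label, weighted by \<open>a e\<close>. The product is
  \<open>cleared_matrix a\<close>.\<close>

lemma det_angle_length_matrix:
  assumes nz: "\<And>e. edge_minor a e \<noteq> 0"
  shows "(\<Prod>e\<in>UNIV. edge_minor a e) * det (angle_length_matrix a) =
    4 * (tree_minor a)\<^sup>2 * (\<Prod>i\<in>UNIV. laplacian a i i)"
proof -
  define L :: "real^(edge + 4)^(edge + 4)" where
    "L = block_matrix (\<lambda>e f. if e = f then edge_minor a e else 0) (\<lambda>_ _. 0) (\<lambda>_ _. 0) (\<lambda>i j. if i = j then 1 else 0)"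
  define R :: "real^(edge + 4)^(edge + 4)" where
    "R = block_matrix (\<lambda>e f. if e = f then 1 else 0) (\<lambda>e i. a e * incidence e i) (\<lambda>_ _. 0) (\<lambda>i j. if i = j then 1 else 0)"
  have "det L = (\<Prod>e\<in>UNIV. edge_minor a e)"
  proof -
    have "det L = det (\<chi> e f. L $ Inl e $ Inl f) * det (\<chi> i j. L $ Inr i $ Inr j)"
      by (rule det_block_lower_triangular) (auto simp: UNIV_sum L_def)
    then show ?thesis by (simp add: L_def det_diagonal_lambda)
  qed
  moreover have "det R = 1"
  proof -
    have "det R = det (\<chi> i j. R $ Inr i $ Inr j) * det (\<chi> e f. R $ Inl e $ Inl f)"
      by (rule det_block_lower_triangular) (auto simp: UNIV_sum R_def)
    then show ?thesis by (simp add: R_def det_diagonal_lambda)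
  qed
  moreover have "L ** angle_length_matrix a ** R = cleared_matrix a"
  proof -
    have "(L ** angle_length_matrix a ** R) $ p $ q = cleared_matrix a $ p $ q" for p q
    proof -
      have LN: "(L ** angle_length_matrix a) $ Inl e $ q = edge_minor a e * angle_length_matrix a $ Inl e $ q"
        "(L ** angle_length_matrix a) $ Inr i $ q = angle_length_matrix a $ Inr i $ q" for e i q
        unfolding matrix_matrix_mult_def
        by (simp_all add: sum_Inl_Inr L_def if_distrib[of "\<lambda>x. x * _"] cong: if_cong)
      have NR: "(M ** R) $ p $ Inl f = M $ p $ Inl f"
        "(M ** R) $ p $ Inr i = (\<Sum>e\<in>UNIV. M $ p $ Inl e * (a e * incidence e i)) + M $ p $ Inr i"
        for M :: "real^(edge + 4)^(edge + 4)" and p f i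
        unfolding matrix_matrix_mult_def
        by (auto simp add: sum_Inl_Inr R_def sum_mult_unit_vector)
      show ?thesis
      proof (cases p)
        case (Inl e)
        show ?thesis
        proof (cases q)
          case (Inl f)
          with \<open>p = Inl e\<close> show ?thesis
            by (simp add: NR LN) (simp add: angle_length_matrix_def cleared_matrix_def nz)
        next
          case (Inr j)
          have "(\<Sum>f\<in>UNIV. (edge_minor a e * (if e = f then a e / edge_minor a e else 0)) * (a f * incidence f j))
              = a e * (a e * incidence e j)"
            using nz[of e] by (simp add: if_distrib[of "\<lambda>x. x * _"] if_distrib[of "\<lambda>x. _ * x"] cong: if_cong)
          \<comment> \<open>Adding \<open>(a e)\<^sup>2\<close> to \<open>edge_minor a e\<close>
            restores the product of the two diagonal entries of the Laplacian.\<close>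
          moreover have "a e * (a e * incidence e j) + edge_minor a e * incidence e j =
              laplacian a (edge_fst e) (edge_fst e) * laplacian a (edge_snd e) (edge_snd e) * incidence e j"
            by (simp add: edge_minor_def power2_eq_square algebra_simps)
          ultimately show ?thesis
            using \<open>p = Inl e\<close> Inr by (simp add: NR LN) (simp add: angle_length_matrix_def cleared_matrix_def)
        qed
      next
        case (Inr i)
        show ?thesis
        proof (cases q)
          case (Inl f)
          with Inr show ?thesis by (simp add: NR LN) (simp add: angle_length_matrix_def cleared_matrix_def)
        next
          case (Inr j)
          \<comment> \<open>This is \<open>J\<^sup>T diag a J - A\<close>: the off-diagonal entries
            cancel, and the diagonal ones add up because the Laplacian has the opposite sign
            there.\<close>
          have "(\<Sum>e\<in>UNIV. incidence e i * (a e * incidence e j)) - laplacian a i j = (if i = j then - 2 * laplacian a i i else 0)"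
            using label_cases[of i] label_cases[of j]
            by (elim disjE) (simp_all add: sum_edge laplacian_def)
          with \<open>p = Inr i\<close> Inr show ?thesis by (simp add: NR LN) (simp add: angle_length_matrix_def cleared_matrix_def)
        qed
      qed
    qed
    then show ?thesis by (simp add: vec_eq_iff)
  qed
  ultimately have "(\<Prod>e\<in>UNIV. edge_minor a e) * det (angle_length_matrix a) = det (cleared_matrix a)"
    by (metis det_mul mult.right_neutral)
  then show ?thesis by (simp add: det_cleared_matrix)
qed

text \<open>The adjugate of the Laplacian with row and column 0 removed, padded by zeros. Divided by
  \<^term>\<open>tree_minor a\<close> it is a generalized inverse of the Laplacian; which one is taken
  does not affect the bordered determinant.\<close>

definition grounded_cofactor :: "(edge \<Rightarrow> real) \<Rightarrow> 4 \<Rightarrow> 4 \<Rightarrow> real" where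
  "grounded_cofactor a i j = (let A = laplacian a in
     if i = 0 \<or> j = 0 then 0
     else if i = j then (if i = 1 then A 2 2 * A 3 3 - (A 2 3)\<^sup>2
       else if i = 2 then A 1 1 * A 3 3 - (A 1 3)\<^sup>2 else A 1 1 * A 2 2 - (A 1 2)\<^sup>2)
     else if i \<noteq> 3 \<and> j \<noteq> 3 then A 1 3 * A 2 3 - A 1 2 * A 3 3
     else if i \<noteq> 2 \<and> j \<noteq> 2 then A 1 2 * A 2 3 - A 1 3 * A 2 2
     else A 1 2 * A 1 3 - A 2 3 * A 1 1)"

lemma laplacian_sym: "laplacian a i j = laplacian a j i"
  by (simp add: laplacian_def edge_between_sym)

lemma laplacian_row_sum: "laplacian a i 0 + laplacian a i 1 + laplacian a i 2 + laplacian a i 3 = 0"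
  using label_cases[of i]
  by (elim disjE) (simp_all add: laplacian_diagonal laplacian_off_diagonal)

lemma grounded_cofactor_sym: "grounded_cofactor a i j = grounded_cofactor a j i"
  by (auto simp: grounded_cofactor_def Let_def)

text \<open>For \<open>j \<noteq> 0\<close> this is adjugate times matrix for the 3 x 3 block of the
  labels 1, 2, 3. Column 0 of the Laplacian is minus the sum of the other columns, which gives the
  case \<open>j = 0\<close>.\<close>

lemma grounded_cofactor_laplacian:
  assumes "i \<noteq> 0"
  shows "grounded_cofactor a i 1 * laplacian a 1 j + grounded_cofactor a i 2 * laplacian a 2 j +
    grounded_cofactor a i 3 * laplacian a 3 j =
    (if i = j then tree_minor a else if j = 0 then - tree_minor a else 0)"
proof -
  have nonzero: "grounded_cofactor a i 1 * laplacian a 1 j + grounded_cofactor a i 2 * laplacian a 2 j +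
    grounded_cofactor a i 3 * laplacian a 3 j = (if i = j then tree_minor a else 0)" if "j \<noteq> 0" for j
    using label_cases[of i] label_cases[of j] assms that
    by (elim disjE) (simp_all add: grounded_cofactor_def Let_def tree_minor_expand laplacian_off_diagonal
        power2_eq_square algebra_simps)
  show ?thesis
  proof (cases "j = 0")
    case True
    have row: "laplacian a k 0 = - (laplacian a k 1 + laplacian a k 2 + laplacian a k 3)" for k
      using laplacian_row_sum[of a k] by linarith
    have "grounded_cofactor a i 1 * laplacian a 1 0 + grounded_cofactor a i 2 * laplacian a 2 0 +
        grounded_cofactor a i 3 * laplacian a 3 0 =
      - ((if i = 1 then tree_minor a else 0) + (if i = 2 then tree_minor a else 0) + (if i = 3 then tree_minor a else 0))"
      unfolding row nonzero[of 1, simplified, symmetric] nonzero[of 2, simplified, symmetric] nonzero[of 3, simplified, symmetric]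
      by (simp add: algebra_simps)
    also have "\<dots> = - tree_minor a"
      using label_cases[of i] assms by (elim disjE) simp_all
    finally show ?thesis using True assms by simp
  qed (simp add: nonzero)
qed

section \<open>Elimination of the labels 1, 2, 3\<close>

text \<open>In the type \<open>3\<close> the numeral 3 equals 0, so the last branch covers that one
  element under both names.\<close>

definition nonzero_label :: "3 \<Rightarrow> 4" where
  "nonzero_label k = (if k = 1 then 1 else if k = 2 then 2 else 3)"

lemma nonzero_label_simps [simp]:
  "nonzero_label 1 = 1" "nonzero_label 2 = 2" "nonzero_label 3 = 3" "nonzero_label 0 = 3"
  by (simp_all add: nonzero_label_def)

definition bordered_matrix :: "(edge \<Rightarrow> 'a::zero) \<Rightarrow> (edge \<Rightarrow> edge \<Rightarrow> 'a) \<Rightarrow> 'a^(edge option)^(edge option)" where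
  "bordered_matrix u E = (\<chi> p q. case p of
     None \<Rightarrow> (case q of None \<Rightarrow> 0 | Some f \<Rightarrow> u f)
   | Some e \<Rightarrow> (case q of None \<Rightarrow> u e | Some f \<Rightarrow> E e f))"

lemma bordered_matrix_nth [simp]:
  "bordered_matrix u E $ None $ None = 0"
  "bordered_matrix u E $ None $ Some f = u f"
  "bordered_matrix u E $ Some e $ None = u e"
  "bordered_matrix u E $ Some e $ Some f = E e f"
  by (simp_all add: bordered_matrix_def)

text \<open>The matrix \<open>J G J\<^sup>T\<close>, where \<open>G\<close> is the padded adjugate;
  divided by \<open>tree_minor a\<close> it plays the part of
  \<open>J A\<^sup>+ J\<^sup>T\<close>.\<close>

definition reduced_form :: "(edge \<Rightarrow> real) \<Rightarrow> edge \<Rightarrow> edge \<Rightarrow> real" where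
  "reduced_form a e f = (\<Sum>i\<in>UNIV. \<Sum>j\<in>UNIV. incidence e i * grounded_cofactor a i j * incidence f j)"

text \<open>Schur complement with respect to the labels 1, 2, 3, whose block is minus the grounded
  Laplacian and has determinant \<open>- tree_minor a\<close>. What is left are the edges and label
  0. Since the constant vector spans the relation among the rows, label 0 turns into a border with
  constant entries.\<close>

lemma det_angle_length_bordered:
  assumes nz: "tree_minor a \<noteq> 0"
  shows "det (angle_length_matrix a) = - tree_minor a * det (bordered_matrix (\<lambda>_. 2)
    (\<lambda>e f. (if e = f then a e / edge_minor a e else 0) + reduced_form a e f / tree_minor a))"
proof -
  let ?A = "angle_length_matrix a"
  define f :: "edge option \<Rightarrow> edge + 4" where "f p = (case p of None \<Rightarrow> Inr 0 | Some e \<Rightarrow> Inl e)" for p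
  define g :: "3 \<Rightarrow> edge + 4" where "g k = Inr (nonzero_label k)" for k
  define G where "G = grounded_cofactor a"
  have f_simps [simp]: "f None = Inr 0" "f (Some e) = Inl e" for e by (simp_all add: f_def)
  \<comment> \<open>The inverse of the eliminated block \<open>- A\<close>, which is why the
    adjugate enters with a minus sign.\<close>
  define T' :: "real^3^3" where
    "T' = (\<chi> k l. - (grounded_cofactor a (nonzero_label k) (nonzero_label l) / tree_minor a))"
  have "det ?A = det (\<chi> i j. ?A $ g i $ g j) *
    det (\<chi> i j. ?A $ f i $ f j - (\<Sum>k\<in>UNIV. \<Sum>l\<in>UNIV. ?A $ f i $ g k * T' $ k $ l * ?A $ g l $ f j))"
  proof (rule det_Schur)
    show "inj f" by (auto simp: inj_def f_def split: option.splits)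
    show "inj g"
    proof (rule injI)
      fix k l assume "g k = g l"
      then show "k = l" using exhaust_3[of k] exhaust_3[of l] by (auto simp: g_def)
    qed
    show "range f \<inter> range g = {}"
      by (auto simp: f_def g_def nonzero_label_def split: option.splits if_splits)
    show "range f \<union> range g = UNIV"
    proof -
      have "p \<in> range f \<union> range g" for p
      proof (cases p)
        case (Inl e) then show ?thesis by (auto intro: range_eqI[of _ _ "Some e"])
      next
        case (Inr i)
        with label_cases[of i] show ?thesis
          by (auto simp: g_def intro: range_eqI[of _ _ None] range_eqI[of _ _ 1] range_eqI[of _ _ 2] range_eqI[of _ _ 3])
      qed
      then show ?thesis by blast
    qed
    show "T' ** (\<chi> i j. ?A $ g i $ g j) = mat 1"
    proof -
      have "(T' ** (\<chi> i j. ?A $ g i $ g j)) $ k $ l = mat 1 $ k $ l" for k l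
      proof -
        have "(T' ** (\<chi> i j. ?A $ g i $ g j)) $ k $ l = (G (nonzero_label k) 1 * laplacian a 1 (nonzero_label l)
            + G (nonzero_label k) 2 * laplacian a 2 (nonzero_label l)
            + G (nonzero_label k) 3 * laplacian a 3 (nonzero_label l)) / tree_minor a"
          by (simp add: matrix_matrix_mult_def sum_3 T'_def g_def angle_length_matrix_def add_divide_distrib G_def)
        also have "\<dots> = (if k = l then 1 else 0)"
          using exhaust_3[of k] exhaust_3[of l] nz unfolding G_def
          by (subst grounded_cofactor_laplacian) (auto simp: nonzero_label_def)
        finally show ?thesis by (simp add: mat_def)
      qed
      then show ?thesis by (simp add: vec_eq_iff)
    qed
  qed
  also have "det (\<chi> i j. ?A $ g i $ g j) = - tree_minor a"
    by (simp add: tree_minor_def det_3 g_def angle_length_matrix_def)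
  also have "(\<chi> i j. ?A $ f i $ f j - (\<Sum>k\<in>UNIV. \<Sum>l\<in>UNIV. ?A $ f i $ g k * T' $ k $ l * ?A $ g l $ f j)) =
     bordered_matrix (\<lambda>_. 2)
    (\<lambda>e f. (if e = f then a e / edge_minor a e else 0) + reduced_form a e f / tree_minor a)" (is "?L = ?R")
  proof -
    \<comment> \<open>The corner reduces to minus the sum of row 0 of the Laplacian.\<close>
    have nn: "?L $ None $ None = 0"
    proof -
      have "?L $ None $ None = - laplacian a 0 0 + (laplacian a 0 1 * (G 1 1 * laplacian a 1 0 + G 1 2 * laplacian a 2 0 + G 1 3 * laplacian a 3 0)
         + laplacian a 0 2 * (G 2 1 * laplacian a 1 0 + G 2 2 * laplacian a 2 0 + G 2 3 * laplacian a 3 0)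
         + laplacian a 0 3 * (G 3 1 * laplacian a 1 0 + G 3 2 * laplacian a 2 0 + G 3 3 * laplacian a 3 0)) / tree_minor a"
        by (simp add: sum_3 T'_def g_def angle_length_matrix_def G_def ring_distribs add_divide_distrib)
      also have "\<dots> = - laplacian a 0 0 - (laplacian a 0 1 + laplacian a 0 2 + laplacian a 0 3)"
        unfolding G_def using nz by (simp add: grounded_cofactor_laplacian) (simp add: field_simps)
      also have "\<dots> = 0" using laplacian_row_sum[of a 0] by linarith
      finally show ?thesis .
    qed
    \<comment> \<open>Elimination adds the incidences of \<open>e\<close> with 1, 2, 3 to that with
      0, and an edge has two endpoints.\<close>
    have ne: "?L $ None $ Some e = 2 \<and> ?L $ Some e $ None = 2" for e
    proof -
      have "?L $ Some e $ None = incidence e 0 - (incidence e 1 * (G 1 1 * laplacian a 1 0 + G 1 2 * laplacian a 2 0 + G 1 3 * laplacian a 3 0)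
         + incidence e 2 * (G 2 1 * laplacian a 1 0 + G 2 2 * laplacian a 2 0 + G 2 3 * laplacian a 3 0)
         + incidence e 3 * (G 3 1 * laplacian a 1 0 + G 3 2 * laplacian a 2 0 + G 3 3 * laplacian a 3 0)) / tree_minor a"
        by (simp add: sum_3 T'_def g_def angle_length_matrix_def G_def ring_distribs add_divide_distrib)
      also have "\<dots> = incidence e 0 + incidence e 1 + incidence e 2 + incidence e 3"
        unfolding G_def using nz by (simp add: grounded_cofactor_laplacian) (simp add: field_simps)
      also have "\<dots> = 2" using edge_cases[of e] by (elim disjE) simp_all
      finally have 1: "?L $ Some e $ None = 2" .
      have "?L $ None $ Some e = ?L $ Some e $ None"
        by (simp add: sum_3 T'_def g_def angle_length_matrix_def laplacian_sym[of a _ 0]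
          grounded_cofactor_sym[of a 2 1] grounded_cofactor_sym[of a 3 1] grounded_cofactor_sym[of a 3 2] algebra_simps)
      with 1 show ?thesis by simp
    qed
    \<comment> \<open>The terms of \<open>reduced_form\<close> that involve label 0 vanish by the
      padding with zeros, so summing over three labels is enough.\<close>
    have ee: "?L $ Some e $ Some h = (if e = h then a e / edge_minor a e else 0) + reduced_form a e h / tree_minor a" for e h
      by (simp add: sum_3 sum_label T'_def g_def angle_length_matrix_def reduced_form_def grounded_cofactor_def[of _ 0] grounded_cofactor_def[of _ _ 0] add_divide_distrib)
    have "?L $ p $ q = ?R $ p $ q" for p q
      using nn ne ee by (cases p; cases q) (auto simp only: bordered_matrix_nth)
    then show ?thesis by (simp add: vec_eq_iff)
  qed
  finally show ?thesis .
qed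

section \<open>First and second derivatives of the determinant on symmetric matrices\<close>

definition opposite_edge :: "edge \<Rightarrow> edge" where
  "opposite_edge e = (if e = edge_between 0 1 then edge_between 2 3
     else if e = edge_between 0 2 then edge_between 1 3
     else if e = edge_between 0 3 then edge_between 1 2
     else if e = edge_between 1 2 then edge_between 0 3
     else if e = edge_between 1 3 then edge_between 0 2 else edge_between 0 1)"

lemma opposite_edge_simps [simp]:
  "opposite_edge (edge_between 0 1) = edge_between 2 3"
  "opposite_edge (edge_between 0 2) = edge_between 1 3"
  "opposite_edge (edge_between 0 3) = edge_between 1 2"
  "opposite_edge (edge_between 1 2) = edge_between 0 3"
  "opposite_edge (edge_between 1 3) = edge_between 0 2"
  "opposite_edge (edge_between 2 3) = edge_between 0 1"
  by (simp_all add: opposite_edge_def)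

text \<open>Meaningful for edges with exactly one common label.\<close>

definition shared_label :: "edge \<Rightarrow> edge \<Rightarrow> 4" where
  "shared_label e f = (if edge_fst e = edge_fst f \<or> edge_fst e = edge_snd f then edge_fst e else edge_snd e)"

text \<open>The derivative of \<open>det C\<close> at a symmetric \<open>C\<close> when the entries
  \<open>ij\<close> and \<open>ji\<close> vary together, that is, twice the cofactor at
  \<open>ij\<close>. The labels \<open>k\<close> and \<open>l\<close> are the remaining two.\<close>

definition det_deriv :: "(4 \<Rightarrow> 4 \<Rightarrow> real) \<Rightarrow> edge \<Rightarrow> real" where
  "det_deriv C e = (let i = edge_fst e; j = edge_snd e; k = edge_fst (opposite_edge e); l = edge_snd (opposite_edge e) in
     2 * (C i k * C j k * C l l + C i l * C j l * C k k - C i j * (C k k * C l l - (C k l)\<^sup>2)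
       - C k l * (C i k * C j l + C i l * C j k)))"

text \<open>The second derivative in the symmetric entry pairs \<open>e\<close> and
  \<open>f\<close>, which coincide, are disjoint, or share one label. In the last case
  \<open>e\<close> and \<open>f\<close> have a common label \<open>i\<close>, their other ends are
  \<open>j\<close> and \<open>k\<close>, and \<open>l\<close> is the fourth label.\<close>

definition det_deriv2 :: "(4 \<Rightarrow> 4 \<Rightarrow> real) \<Rightarrow> edge \<Rightarrow> edge \<Rightarrow> real" where
  "det_deriv2 C e f = (
     if e = f then let k = edge_fst (opposite_edge e); l = edge_snd (opposite_edge e) in
       - 2 * (C k k * C l l - (C k l)\<^sup>2)
     else if f = opposite_edge e then
       let i = edge_fst e; j = edge_snd e; k = edge_fst f; l = edge_snd f in
       4 * C i j * C k l - 2 * (C i k * C j l + C i l * C j k)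
     else let j = shared_label e (opposite_edge f); k = shared_label f (opposite_edge e);
         l = shared_label (opposite_edge e) (opposite_edge f) in
       2 * (C l l * C j k - C j l * C k l))"

text \<open>The derivative is twice a cofactor, and all cofactors of a Laplacian equal
  \<open>tree_minor a\<close>.\<close>

lemma det_deriv_laplacian: "det_deriv (laplacian a) e = 2 * tree_minor a"
  using edge_cases[of e]
  by (elim disjE) (simp_all add: det_deriv_def Let_def tree_minor_expand laplacian_off_diagonal,
    simp_all add: laplacian_diagonal power2_eq_square algebra_simps)

text \<open>The terms \<open>u e\<close> and \<open>u f\<close> depend on the row or the column
  only, so they can be removed with the constant border. Up to them the second derivative is
  \<open>- 2 J G J\<^sup>T\<close>.\<close>

lemma det_deriv2_laplacian:
  fixes a defines "u e \<equiv> 4 * grounded_cofactor a (edge_fst e) (edge_snd e)"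
  shows "det_deriv2 (laplacian a) e f = u e + u f - 2 * reduced_form a e f"
  using edge_cases[of e] edge_cases[of f]
  by (elim disjE) (simp_all add: u_def det_deriv2_def shared_label_def reduced_form_def sum_label grounded_cofactor_def Let_def
     laplacian_off_diagonal laplacian_diagonal power2_eq_square algebra_simps)

section \<open>Factorization of the bordered Hessian\<close>

lemma sum_option:
  fixes h :: "'b::finite option \<Rightarrow> 'a::comm_monoid_add"
  shows "(\<Sum>p\<in>UNIV. h p) = h None + (\<Sum>e\<in>UNIV. h (Some e))"
  by (simp add: UNIV_option_conv sum.reindex)

text \<open>The matrix is \<open>X ** B ** Y\<close> with \<open>B\<close> the bordered matrix
  obtained by elimination. The block triangular factors \<open>X\<close> and \<open>Y\<close> put in
  the scaling by \<open>l\<close> and, through multiples of the border, the terms \<open>u e\<close>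
  and \<open>u f\<close>.\<close>

lemma det_bordered_hessian:
  assumes minor: "\<And>e. edge_minor a e \<noteq> 0" and tree: "tree_minor a \<noteq> 0" and \<kappa>: "\<kappa> \<noteq> 0"
  shows "det (bordered_matrix (\<lambda>e. \<gamma> * l e) (\<lambda>e f. \<kappa> * l e * l f *
      (det_deriv2 (laplacian a) e f - (if e = f then 2 * tree_minor a * a e / edge_minor a e else 0)))) *
      (\<Prod>e\<in>UNIV. edge_minor a e) =
    32 * \<gamma>\<^sup>2 * \<kappa>^5 * tree_minor a ^ 6 * (\<Prod>e\<in>UNIV. l e)\<^sup>2 * (\<Prod>i\<in>UNIV. laplacian a i i)" (is "det ?M * _ = _")
proof -
  let ?\<alpha> = "tree_minor a"
  define u where "u e = 4 * grounded_cofactor a (edge_fst e) (edge_snd e)" for e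
  define B where "B = bordered_matrix (\<lambda>_. 2)
    (\<lambda>e f. (if e = f then a e / edge_minor a e else 0) + reduced_form a e f / ?\<alpha>)"
  \<comment> \<open>The border row of \<open>B\<close> has entries 2, so half of
    \<open>\<kappa> * l e * u e\<close> times it contributes the term with
    \<open>u e\<close>.\<close>
  define X :: "real^(edge option)^(edge option)" where "X = (\<chi> p q. case p of
      None \<Rightarrow> (case q of None \<Rightarrow> \<gamma> / 2 | Some f \<Rightarrow> 0)
    | Some e \<Rightarrow> (case q of None \<Rightarrow> \<kappa> * l e * u e / 2 | Some f \<Rightarrow> if e = f then - 2 * ?\<alpha> * \<kappa> * l e else 0))"
  \<comment> \<open>After multiplication by \<open>X\<close> the border column has entries
    \<open>- 4 * tree_minor a * \<kappa> * l e\<close>. The coefficients in the first row of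
    \<open>Y\<close> turn this into \<open>\<gamma> * l e\<close> and into the term with
    \<open>u f\<close>.\<close>
  define Y :: "real^(edge option)^(edge option)" where "Y = (\<chi> p q. case p of
      None \<Rightarrow> (case q of None \<Rightarrow> - \<gamma> / (4 * ?\<alpha> * \<kappa>) | Some f \<Rightarrow> - l f * u f / (4 * ?\<alpha>))
    | Some e \<Rightarrow> (case q of None \<Rightarrow> 0 | Some f \<Rightarrow> if e = f then l e else 0))"
  have X_nth: "X $ None $ None = \<gamma> / 2" "X $ None $ Some f = 0" "X $ Some e $ None = \<kappa> * l e * u e / 2"
    "X $ Some e $ Some f = (if e = f then - 2 * ?\<alpha> * \<kappa> * l e else 0)" for e f
    by (simp_all add: X_def)
  have Y_nth: "Y $ None $ None = - \<gamma> / (4 * ?\<alpha> * \<kappa>)" "Y $ None $ Some f = - l f * u f / (4 * ?\<alpha>)"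
    "Y $ Some e $ None = 0" "Y $ Some e $ Some f = (if e = f then l e else 0)" for e f
    by (simp_all add: Y_def)
  have None_range: "insert None (range Some) = (UNIV :: edge option set)"
  proof -
    have "p \<in> insert None (range Some)" for p :: "edge option"
      by (cases p) simp_all
    then show ?thesis by blast
  qed
  \<comment> \<open>The border is a block of size one, indexed by the type \<open>1\<close>.\<close>
  have "det X = det (\<chi> i j :: 1. X $ None $ None) * det (\<chi> e f. X $ Some e $ Some f)"
    by (rule det_block_lower_triangular[of "\<lambda>_::1. None" Some]) (simp_all add: None_range X_nth inj_def image_iff)
  also have "\<dots> = \<gamma> / 2 * (\<Prod>e\<in>UNIV. - 2 * ?\<alpha> * \<kappa> * l e)"
    by (simp only: X_nth det_diagonal_lambda) (simp add: det_1)
  also have "\<dots> = \<gamma> / 2 * (2 * ?\<alpha> * \<kappa>)^6 * (\<Prod>e\<in>UNIV. l e)"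
  proof -
    have "(\<Prod>e\<in>UNIV. - 2 * ?\<alpha> * \<kappa> * l e) = (\<Prod>e\<in>(UNIV :: edge set). - (2 * ?\<alpha> * \<kappa>)) * (\<Prod>e\<in>UNIV. l e)"
      by (simp only: prod.distrib[symmetric] mult_minus_left mult.assoc)
    \<comment> \<open>There are six edges, so the sign drops out.\<close>
    also have "(\<Prod>e\<in>(UNIV :: edge set). - (2 * ?\<alpha> * \<kappa>)) = (2 * ?\<alpha> * \<kappa>)^6"
      unfolding prod_edge by (simp add: power_def numeral_eq_Suc)
    finally show ?thesis by simp
  qed
  finally have detX: "det X = \<gamma> / 2 * (2 * ?\<alpha> * \<kappa>)^6 * (\<Prod>e\<in>UNIV. l e)" .
  have "det Y = det (\<chi> e f. Y $ Some e $ Some f) * det (\<chi> i j :: 1. Y $ None $ None)"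
    by (rule det_block_lower_triangular[of Some "\<lambda>_::1. None"]) (simp_all add: None_range Y_nth inj_def image_iff)
  also have "\<dots> = (\<Prod>e\<in>UNIV. l e) * (- \<gamma> / (4 * ?\<alpha> * \<kappa>))"
    by (simp only: Y_nth det_diagonal_lambda) (simp add: det_1)
  finally have detY: "det Y = (\<Prod>e\<in>UNIV. l e) * (- \<gamma> / (4 * ?\<alpha> * \<kappa>))" .
  have XB: "(X ** B) $ None $ q = \<gamma> / 2 * B $ None $ q"
    "(X ** B) $ Some e $ q = \<kappa> * l e * u e / 2 * B $ None $ q - 2 * ?\<alpha> * \<kappa> * l e * B $ Some e $ q" for e q
    unfolding matrix_matrix_mult_def
    by (simp_all add: sum_option X_nth if_distrib[of "\<lambda>x. x * _"] cong: if_cong)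
  have MY: "(M ** Y) $ p $ None = M $ p $ None * (- \<gamma> / (4 * ?\<alpha> * \<kappa>))"
    "(M ** Y) $ p $ Some f = M $ p $ None * (- l f * u f / (4 * ?\<alpha>)) + M $ p $ Some f * l f"
      for M :: "real^(edge option)^(edge option)" and p f
    unfolding matrix_matrix_mult_def
    by (simp_all add: sum_option Y_nth if_distrib[of "\<lambda>x. _ * x"] cong: if_cong)
  have hess: "det_deriv2 (laplacian a) e f = u e + u f - 2 * reduced_form a e f" for e f
    unfolding u_def by (rule det_deriv2_laplacian)
  have "?M $ p $ q = (X ** B ** Y) $ p $ q" for p q
  proof (cases p)
    case None
    then show ?thesis using tree \<kappa> by (cases q) (simp_all add: MY XB, simp_all add: B_def)
  next
    case (Some e)
    show ?thesis
    proof (cases q)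
      case None
      then show ?thesis using Some tree \<kappa> by (simp add: MY XB) (simp add: B_def)
    next
      case (Some f)
      define d where "d = (if e = f then a e / edge_minor a e else 0)"
      have d: "(if e = f then 2 * ?\<alpha> * a e / edge_minor a e else 0) = 2 * ?\<alpha> * d"
        by (simp add: d_def)
      have "(X ** B ** Y) $ Some e $ Some f = - 2 * ?\<alpha> * \<kappa> * l e * 2 * (- l f * u f / (4 * ?\<alpha>)) +
          (\<kappa> * l e * u e / 2 * 2 - 2 * ?\<alpha> * \<kappa> * l e * (d + reduced_form a e f / ?\<alpha>)) * l f"
        by (simp only: MY XB) (simp add: B_def d_def)
      also have "\<dots> = \<kappa> * l e * l f * (u e + u f - 2 * reduced_form a e f - 2 * ?\<alpha> * d)"
        using tree by (simp add: divide_simps) (simp add: algebra_simps)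
      finally show ?thesis
        using \<open>p = Some e\<close> Some by (simp only: bordered_matrix_nth hess d)
    qed
  qed
  then have "?M = X ** B ** Y" by (simp add: vec_eq_iff)
  then have "det ?M = det X * det B * det Y" by (simp add: det_mul)
  \<comment> \<open>One factor \<open>- tree_minor a\<close> is kept with \<open>det B\<close>, to
    be recombined into the 10 x 10 determinant.\<close>
  also have "\<dots> = 8 * \<gamma>\<^sup>2 * ?\<alpha>^4 * \<kappa>^5 * (\<Prod>e\<in>UNIV. l e)\<^sup>2 * (- ?\<alpha> * det B)"
  proof -
    have "x / 2 * (2 * c * k)^6 * L * y * (L * (- x / (4 * c * k))) = 8 * x\<^sup>2 * c^4 * k^5 * L\<^sup>2 * (- c * y)"
      if "c \<noteq> 0" "k \<noteq> 0" for x c k L y :: real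
      using that by (simp add: divide_simps) (simp add: power_def numeral_eq_Suc)
    then show ?thesis unfolding detX detY using tree \<kappa> by simp
  qed
  also have "- ?\<alpha> * det B = det (angle_length_matrix a)"
    unfolding B_def by (rule det_angle_length_bordered[OF tree, symmetric])
  finally have "det ?M * (\<Prod>e\<in>UNIV. edge_minor a e) = 8 * \<gamma>\<^sup>2 * ?\<alpha>^4 * \<kappa>^5 * (\<Prod>e\<in>UNIV. l e)\<^sup>2 *
      ((\<Prod>e\<in>UNIV. edge_minor a e) * det (angle_length_matrix a))"
    by (simp only: ac_simps)
  also have "\<dots> = 8 * \<gamma>\<^sup>2 * ?\<alpha>^4 * \<kappa>^5 * (\<Prod>e\<in>UNIV. l e)\<^sup>2 * (4 * ?\<alpha>\<^sup>2 * (\<Prod>i\<in>UNIV. laplacian a i i))"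
    by (simp only: det_angle_length_matrix[OF minor])
  finally show ?thesis by (simp add: power_def numeral_eq_Suc)
qed

section \<open>Derivatives of the Gram determinant and of the action\<close>

definition gram_entry :: "real^edge \<Rightarrow> 4 \<Rightarrow> 4 \<Rightarrow> real" where
  "gram_entry \<theta> i j = gram \<theta> $ i $ j"

lemma gram_entry_simps:
  "gram_entry \<theta> i i = 1" "i \<noteq> j \<Longrightarrow> gram_entry \<theta> i j = cos (\<theta> $ edge_between i j)"
  by (simp_all add: gram_entry_def gram_def)

lemma shifted_coordinate: "(x + t *\<^sub>R axis e 1) $ f = x $ f + (if e = f then t else (0::real))"
  by (simp add: axis_def)

definition perturb :: "(4 \<Rightarrow> 4 \<Rightarrow> real) \<Rightarrow> edge \<Rightarrow> real \<Rightarrow> 4 \<Rightarrow> 4 \<Rightarrow> real" where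
  "perturb C e d i j = C i j + (if i \<noteq> j \<and> edge_between i j = e then d else 0)"

lemma label_sym:
  fixes C :: "4 \<Rightarrow> 4 \<Rightarrow> real"
  assumes "\<And>i j. C i j = C j i"
  shows "C 1 0 = C 0 1" "C 2 0 = C 0 2" "C 3 0 = C 0 3" "C 2 1 = C 1 2" "C 3 1 = C 1 3" "C 3 2 = C 2 3"
  using assms by blast+

text \<open>As a function of one off-diagonal pair of entries the determinant is quadratic, so the Taylor
  expansion is exact.\<close>

lemma det_perturb:
  assumes "\<And>i j. C i j = C j i"
  shows "det (\<chi> i j. perturb C e d i j) = det (\<chi> i j. C i j) + det_deriv C e * d + det_deriv2 C e e * d\<^sup>2 / 2"
  using edge_cases[of e] label_sym[of C, OF assms]
  by (elim disjE) (simp_all add: det_4 perturb_def det_deriv_def det_deriv2_def Let_def,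
    simp_all add: power2_eq_square field_simps)

text \<open>The square of the entry \<open>e\<close> occurs in the cofactor at \<open>f\<close> only
  through the complementary 2 x 2 minor, hence only for opposite edges. The linear coefficient is
  the mixed second derivative.\<close>

lemma det_deriv_perturb:
  assumes "\<And>i j. C i j = C j i"
  shows "det_deriv (perturb C e d) f = det_deriv C f + det_deriv2 C e f * d
    + (if f = opposite_edge e then 2 * C (edge_fst f) (edge_snd f) else 0) * d\<^sup>2"
  using edge_cases[of e] edge_cases[of f] label_sym[of C, OF assms]
  by (elim disjE) (simp_all add: perturb_def det_deriv_def det_deriv2_def shared_label_def Let_def,
    simp_all add: power2_eq_square algebra_simps)

text \<open>Moving one angle moves one symmetric pair of entries, so the exact expansions in that
  pair apply to the Gram matrix.\<close>

lemma gram_entry_shift: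
  "gram_entry (\<theta> + t *\<^sub>R axis e 1) = perturb (gram_entry \<theta>) e (cos (\<theta> $ e + t) - cos (\<theta> $ e))"
  by (auto simp: fun_eq_iff perturb_def gram_entry_def gram_def axis_def)

lemma gram_entry_sym: "gram_entry \<theta> i j = gram_entry \<theta> j i"
  by (simp add: gram_entry_def gram_def edge_between_sym)

lemma det_gram_shift:
  fixes \<theta> e t defines "d \<equiv> cos (\<theta> $ e + t) - cos (\<theta> $ e)"
  shows "det_gram (\<theta> + t *\<^sub>R axis e 1) =
    det_gram \<theta> + det_deriv (gram_entry \<theta>) e * d + det_deriv2 (gram_entry \<theta>) e e * d\<^sup>2 / 2"
proof -
  have "det_gram \<theta> = det (\<chi> i j. gram_entry \<theta> i j)" for \<theta>
    by (simp add: det_gram_def gram_entry_def)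
  then show ?thesis
    by (simp add: gram_entry_shift det_perturb[OF gram_entry_sym] d_def)
qed

lemma det_deriv_shift:
  fixes \<theta> e t defines "d \<equiv> cos (\<theta> $ e + t) - cos (\<theta> $ e)"
  shows "det_deriv (gram_entry (\<theta> + t *\<^sub>R axis e 1)) f =
    det_deriv (gram_entry \<theta>) f + det_deriv2 (gram_entry \<theta>) e f * d
    + (if f = opposite_edge e then 2 * gram_entry \<theta> (edge_fst f) (edge_snd f) else 0) * d\<^sup>2"
  unfolding gram_entry_shift d_def by (rule det_deriv_perturb[OF gram_entry_sym])

text \<open>The increment of the cosine vanishes at \<open>t = 0\<close> with derivative
  \<open>- sin (\<theta> $ e)\<close>; its square has derivative 0 there.\<close>

lemma has_derivative_det_gram:
  "((\<lambda>t. det_gram (\<theta> + t *\<^sub>R axis e 1)) has_real_derivative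
    - sin (\<theta> $ e) * det_deriv (gram_entry \<theta>) e) (at 0)"
  unfolding det_gram_shift by (auto intro!: derivative_eq_intros)

lemma partial_det_gram: "partial e det_gram \<theta> = - sin (\<theta> $ e) * det_deriv (gram_entry \<theta>) e"
  unfolding partial_def
  using has_derivative_det_gram by (intro vector_derivative_at) (simp add: has_real_derivative_iff_has_vector_derivative)

text \<open>Product rule for \<open>- sin (\<theta> $ f) * det_deriv\<close>: the sine factor varies
  only if \<open>e = f\<close>, which produces the cosine term.\<close>

lemma has_derivative_partial_det_gram:
  "((\<lambda>t. partial f det_gram (\<theta> + t *\<^sub>R axis e 1)) has_real_derivative
    sin (\<theta> $ e) * sin (\<theta> $ f) * det_deriv2 (gram_entry \<theta>) e f
      - (if e = f then cos (\<theta> $ e) * det_deriv (gram_entry \<theta>) e else 0)) (at 0)"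
  unfolding partial_det_gram det_deriv_shift shifted_coordinate
  by (cases "e = f") (auto intro!: derivative_eq_intros)

lemma partial_partial_det_gram:
  "partial e (partial f det_gram) \<theta> = sin (\<theta> $ e) * sin (\<theta> $ f) * det_deriv2 (gram_entry \<theta>) e f
      - (if e = f then cos (\<theta> $ e) * det_deriv (gram_entry \<theta>) e else 0)"
  unfolding partial_def[of e]
  using has_derivative_partial_det_gram by (intro vector_derivative_at) (simp add: has_real_derivative_iff_has_vector_derivative)

section \<open>Partial derivatives of the action\<close>

lemma partial_imaginary:
  assumes "((\<lambda>t. f (x + t *\<^sub>R axis k 1)) has_real_derivative D) (at 0)"
  shows "partial k (\<lambda>x. \<i> * complex_of_real (f x)) x = \<i> * complex_of_real D"
proof -
  have "((\<lambda>t. complex_of_real (f (x + t *\<^sub>R axis k 1))) has_vector_derivative complex_of_real D) (at 0)"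
    using assms by (simp add: has_real_derivative_iff_has_vector_derivative has_vector_derivative_of_real)
  then have "((\<lambda>t. \<i> * complex_of_real (f (x + t *\<^sub>R axis k 1))) has_vector_derivative \<i> * complex_of_real D) (at 0)"
    by (rule has_vector_derivative_mult_right)
  then show ?thesis unfolding partial_def by (rule vector_derivative_at)
qed

lemma shifted_None:
  "(\<chi> e. (x + t *\<^sub>R axis None 1) $ Some e) = (\<chi> e. (x :: real^(edge option)) $ Some e)"
  by (simp add: vec_eq_iff axis_def)

lemma shifted_Some:
  "(\<chi> f. (x + t *\<^sub>R axis (Some e) 1) $ Some f) = (\<chi> f. (x :: real^(edge option)) $ Some f) + t *\<^sub>R axis e 1"
  by (simp add: vec_eq_iff axis_def)

lemma partial_action_None:
  "partial None (action p) = (\<lambda>x. \<i> * complex_of_real (- norm (lengths p) * det_gram (\<chi> e. x $ Some e)))"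
proof
  fix x
  show "partial None (action p) x = \<i> * complex_of_real (- norm (lengths p) * det_gram (\<chi> e. x $ Some e))"
    unfolding action_def
    by (rule partial_imaginary, unfold shifted_None, unfold shifted_coordinate)
      (auto intro!: derivative_eq_intros)
qed

lemma partial_action_Some:
  "partial (Some e) (action p) =
    (\<lambda>x. \<i> * complex_of_real (lengths p $ e - norm (lengths p) * x $ None * partial e det_gram (\<chi> e. x $ Some e)))"
proof
  fix x
  show "partial (Some e) (action p) x = \<i> * complex_of_real (lengths p $ e - norm (lengths p) * x $ None * partial e det_gram (\<chi> e. x $ Some e))"
    unfolding action_def
  proof (rule partial_imaginary, unfold shifted_Some, unfold shifted_coordinate)
    have "((\<lambda>t. \<Sum>f\<in>UNIV. lengths p $ f * (x $ Some f + (if Some e = Some f then t else 0))) has_real_derivative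
        (\<Sum>f\<in>UNIV. lengths p $ f * (if e = f then 1 else 0))) (at 0)"
      by (intro DERIV_sum) (auto intro!: derivative_eq_intros)
    then have "((\<lambda>t. \<Sum>f\<in>UNIV. lengths p $ f * (x $ Some f + (if Some e = Some f then t else 0))) has_real_derivative lengths p $ e) (at 0)"
      by (simp only: sum_mult_unit_vector)
    then show "((\<lambda>t. (\<Sum>f\<in>UNIV. lengths p $ f * (x $ Some f + (if Some e = Some f then t else 0))) -
        norm (lengths p) * (x $ None + (if Some e = None then t else 0)) * det_gram ((\<chi> f. x $ Some f) + t *\<^sub>R axis e 1))
      has_real_derivative lengths p $ e - norm (lengths p) * x $ None * partial e det_gram (\<chi> e. x $ Some e)) (at 0)"
      using has_derivative_det_gram[of "\<chi> f. x $ Some f" e, folded partial_det_gram]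
      by (intro DERIV_diff) (auto intro!: derivative_eq_intros)
  qed
qed

lemma stationary_point_simps [simp]:
  "stationary_point p $ None = rho p" "(\<chi> e. stationary_point p $ Some e) = angles p"
  by (simp_all add: stationary_point_def)

text \<open>The first partial derivatives are known as functions on the whole space and can be
  differentiated again. The action is affine in \<open>\<rho>\<close>, hence the zero
  corner.\<close>

lemma partial_partial_action:
  "partial a (partial b (action p)) (stationary_point p) = H_matrix p $ a $ b"
proof (cases b)
  case None
  show ?thesis
  proof (cases a)
    case None
    have "partial None (partial None (action p)) (stationary_point p) = \<i> * complex_of_real 0"
      unfolding partial_action_None
      by (rule partial_imaginary, unfold shifted_None) (auto intro!: derivative_eq_intros)
    with None \<open>b = None\<close> show ?thesis by (simp add: H_matrix_def)
  next
    case (Some e)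
    have "partial (Some e) (partial None (action p)) (stationary_point p) =
        \<i> * complex_of_real (- norm (lengths p) * partial e det_gram (angles p))"
      unfolding partial_action_None
      by (rule partial_imaginary, unfold shifted_Some)
        (use has_derivative_det_gram[of "angles p" e, folded partial_det_gram] in \<open>auto intro!: derivative_eq_intros\<close>)
    with Some \<open>b = None\<close> show ?thesis by (simp add: H_matrix_def)
  qed
next
  case (Some f)
  show ?thesis
  proof (cases a)
    case None
    have "partial None (partial (Some f) (action p)) (stationary_point p) =
        \<i> * complex_of_real (- norm (lengths p) * partial f det_gram (angles p))"
      unfolding partial_action_Some
      by (rule partial_imaginary, unfold shifted_None, unfold shifted_coordinate) (auto intro!: derivative_eq_intros)
    with None \<open>b = Some f\<close> show ?thesis by (simp add: H_matrix_def)
  next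
    case (Some e)
    have "partial (Some e) (partial (Some f) (action p)) (stationary_point p) =
        \<i> * complex_of_real (- norm (lengths p) * rho p * partial e (partial f det_gram) (angles p))"
      unfolding partial_action_Some
      by (rule partial_imaginary, unfold shifted_Some, unfold shifted_coordinate)
        (use has_derivative_partial_det_gram[of f "angles p" e, folded partial_partial_det_gram] in \<open>auto intro!: derivative_eq_intros\<close>)
    with Some \<open>b = Some f\<close> show ?thesis by (simp add: H_matrix_def)
  qed
qed

section \<open>Face vectors, lengths, volume and angles\<close>

unbundle cross3_syntax

text \<open>Six times the signed volume.\<close>

definition tetra_det :: "(4 \<Rightarrow> real^3) \<Rightarrow> real" where
  "tetra_det p = (p 1 - p 0) \<bullet> ((p 2 - p 0) \<times> (p 3 - p 0))"

text \<open>Twice the vector area of a face. The sign makes \<open>face_vector p i \<bullet> (p i - x)\<close> equal to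
  \<open>tetra_det p\<close> for every \<open>i\<close> and every \<open>x\<close> in face \<open>i\<close>.\<close>

definition face_vector :: "(4 \<Rightarrow> real^3) \<Rightarrow> 4 \<Rightarrow> real^3" where
  "face_vector p i = (if i = 1 \<or> i = 3 then 1 else - 1) *\<^sub>R
     ((p (i + 2) - p (i + 1)) \<times> (p (i + 3) - p (i + 1)))"

lemma face_vector_simps:
  fixes p defines "u i \<equiv> p i - p 0"
  shows "face_vector p 1 = u 2 \<times> u 3" "face_vector p 2 = u 3 \<times> u 1" "face_vector p 3 = u 1 \<times> u 2"
    "face_vector p 0 = - (u 2 \<times> u 3) - u 3 \<times> u 1 - u 1 \<times> u 2"
proof -
  have labels: "(0::4) + 1 = 1" "(0::4) + 2 = 2" "(0::4) + 3 = 3" "(1::4) + 1 = 2" "(1::4) + 2 = 3" "(1::4) + 3 = 0"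
    "(2::4) + 1 = 3" "(2::4) + 2 = 0" "(2::4) + 3 = 1" "(3::4) + 1 = 0" "(3::4) + 2 = 1" "(3::4) + 3 = 2"
    by simp_all
  have "face_vector p 1 = (p 3 - p 2) \<times> (p 0 - p 2)" "face_vector p 2 = - ((p 0 - p 3) \<times> (p 1 - p 3))"
    "face_vector p 3 = (p 1 - p 0) \<times> (p 2 - p 0)" "face_vector p 0 = - ((p 2 - p 1) \<times> (p 3 - p 1))"
    by (simp_all only: face_vector_def labels) simp_all
  then show "face_vector p 1 = u 2 \<times> u 3" "face_vector p 2 = u 3 \<times> u 1" "face_vector p 3 = u 1 \<times> u 2"
    "face_vector p 0 = - (u 2 \<times> u 3) - u 3 \<times> u 1 - u 1 \<times> u 2"
    by (simp_all only: u_def) (simp_all add: cross3_simps)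
qed

lemma norm_face_vector: "norm (face_vector p i) = 2 * face_area p i"
  by (simp add: face_vector_def face_area_def triangle_area_def)

lemma face_vector_dot_vertex:
  "face_vector p i \<bullet> (p j - p 0) = (if i = j then tetra_det p else 0) - (if i = 0 then tetra_det p else 0)"
proof -
  define u1 u2 u3 where u: "u1 = p 1 - p 0" "u2 = p 2 - p 0" "u3 = p 3 - p 0"
  show ?thesis
    using label_cases[of i] label_cases[of j]
    by (elim disjE) (simp_all add: face_vector_simps tetra_det_def u[symmetric] inner_diff_left dot_cross_self,
       simp_all add: cross3_simps)
qed

lemma face_vector_dot_diff:
  "face_vector p i \<bullet> (p j - p k) = (if i = j then tetra_det p else 0) - (if i = k then tetra_det p else 0)"
proof -
  have "face_vector p i \<bullet> (p j - p k) = face_vector p i \<bullet> (p j - p 0) - face_vector p i \<bullet> (p k - p 0)"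
    by (simp add: inner_diff_right)
  then show ?thesis by (simp add: face_vector_dot_vertex)
qed

text \<open>The vertices of the face lie in one level set of the functional; a hyperplane is convex,
  so it contains their hull.\<close>

lemma face_vector_dot_face:
  assumes "x \<in> face p i" "j \<noteq> i"
  shows "face_vector p i \<bullet> x = face_vector p i \<bullet> p j"
proof -
  have "face_vector p i \<bullet> p k = face_vector p i \<bullet> p j" if "k \<noteq> i" for k
    using face_vector_dot_diff[of p i k j] that assms(2) by (simp add: inner_diff_right)
  then have "p ` (- {i}) \<subseteq> {x. face_vector p i \<bullet> x = face_vector p i \<bullet> p j}" by auto
  then have "face p i \<subseteq> {x. face_vector p i \<bullet> x = face_vector p i \<bullet> p j}"
    unfolding face_def by (intro hull_minimal convex_hyperplane)
  then show ?thesis using assms(1) by blast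
qed

lemma vertex_in_face: "j \<noteq> i \<Longrightarrow> p j \<in> face p i"
  unfolding face_def by (rule hull_inc) auto

text \<open>A vector orthogonal to two edges of a face is a multiple of their cross product. Unit
  length fixes the modulus of the factor. The face vector points to the side of \<open>p i\<close>
  exactly if \<open>tetra_det p\<close> is positive, which fixes the sign.\<close>

lemma outward_normal_eq:
  assumes d: "tetra_det p \<noteq> 0"
  shows "outward_normal p i = - (sgn (tetra_det p) / norm (face_vector p i)) *\<^sub>R face_vector p i"
proof -
  let ?m = "face_vector p i" and ?d = "tetra_det p"
  have labels: "i + 1 \<noteq> i" "i + 2 \<noteq> i" "i + 3 \<noteq> i" by simp_all
  have height: "?m \<bullet> (p i - x) = ?d" if "x \<in> face p i" for x
    using face_vector_dot_face[OF that labels(1)] face_vector_dot_diff[of p i i "i + 1"]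
    by (simp add: inner_diff_right)
  then have m: "?m \<noteq> 0"
    using d vertex_in_face[OF labels(1)] by force
  show ?thesis
    unfolding outward_normal_def
  proof (rule the_equality)
    let ?n = "- (sgn ?d / norm ?m) *\<^sub>R ?m"
    have "norm ?n = 1" using m d by (simp add: abs_sgn_eq)
    moreover have "?n \<bullet> (x - y) = 0" if "x \<in> face p i" "y \<in> face p i" for x y
      using face_vector_dot_face[OF that(1) labels(1)] face_vector_dot_face[OF that(2) labels(1)]
      by (simp add: inner_diff_right)
    moreover have "?n \<bullet> (p i - x) < 0" if "x \<in> face p i" for x
      using height[OF that] d m by (simp add: abs_sgn[symmetric] mult.commute[of "sgn _"])
    ultimately show "norm ?n = 1 \<and> (\<forall>x\<in>face p i. \<forall>y\<in>face p i. ?n \<bullet> (x - y) = 0) \<and>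
        (\<forall>x\<in>face p i. ?n \<bullet> (p i - x) < 0)" by blast
  next
    fix n assume n: "norm n = 1 \<and> (\<forall>x\<in>face p i. \<forall>y\<in>face p i. n \<bullet> (x - y) = 0) \<and>
        (\<forall>x\<in>face p i. n \<bullet> (p i - x) < 0)"
    have "n \<bullet> (p (i + 2) - p (i + 1)) = 0" "n \<bullet> (p (i + 3) - p (i + 1)) = 0"
      using n vertex_in_face labels by blast+
    \<comment> \<open>Expanding the double cross product leaves only multiples of the two vanishing
      inner products.\<close>
    then have "n \<times> ?m = 0"
      by (simp add: face_vector_def cross_mult_right Lagrange)
    then have "(?m \<bullet> ?m) *\<^sub>R n = (?m \<bullet> n) *\<^sub>R ?m"
      using Lagrange[of ?m n ?m] by simp
    then have "n = ((?m \<bullet> n) / (?m \<bullet> ?m)) *\<^sub>R ?m"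
      using m by (metis (no_types, lifting) inner_eq_zero_iff divideR_right scaleR_scaleR divide_inverse mult.commute)
    then obtain c where c: "n = c *\<^sub>R ?m" by blast
    have "c * ?d < 0"
      using n height[OF vertex_in_face[OF labels(1)]] vertex_in_face[OF labels(1)] c
      by (metis inner_scaleR_left)
    moreover have "\<bar>c\<bar> * norm ?m = 1" using n c by simp
    ultimately have "c = - (sgn ?d / norm ?m)"
      using m by (auto simp: field_simps sgn_if mult_less_0_iff split: if_splits)
    then show "n = - (sgn ?d / norm ?m) *\<^sub>R ?m" using c by simp
  qed
qed

text \<open>A point of face \<open>i\<close> is a convex combination of \<open>p j\<close> and a
  point \<open>b\<close> of the opposite side. If it also lies in the plane of face
  \<open>j\<close>, which contains \<open>b\<close> but not \<open>p j\<close>, then the weight of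
  \<open>p j\<close> is 0.\<close>

lemma face_Int_face:
  assumes d: "tetra_det p \<noteq> 0" and "i \<noteq> j"
  shows "face p i \<inter> face p j = convex hull (p ` (- {i, j}))"
proof
  show "convex hull (p ` (- {i, j})) \<subseteq> face p i \<inter> face p j"
    unfolding face_def by (intro Int_greatest hull_mono image_mono) auto
  obtain k where k: "k \<noteq> i" "k \<noteq> j"
  proof -
    have "(0::4) \<noteq> 1" "(0::4) \<noteq> 2" "(1::4) \<noteq> 2" by simp_all
    then show ?thesis using that by metis
  qed
  show "face p i \<inter> face p j \<subseteq> convex hull (p ` (- {i, j}))"
  proof
    fix x assume x: "x \<in> face p i \<inter> face p j"
    have "- {i} = insert j (- {i, j})" using assms(2) by auto
    then have "x \<in> convex hull (insert (p j) (p ` (- {i, j})))"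
      using x by (simp add: face_def)
    moreover have "p ` (- {i, j}) \<noteq> {}" using k by auto
    ultimately obtain u v b where uv: "u + v = 1" "b \<in> convex hull (p ` (- {i, j}))" "x = u *\<^sub>R p j + v *\<^sub>R b"
      unfolding convex_hull_insert[OF \<open>p ` (- {i, j}) \<noteq> {}\<close>] by blast
    let ?m = "face_vector p j"
    have "b \<in> face p j"
      using uv(2) hull_mono[of "p ` (- {i, j})" "p ` (- {j})" convex] unfolding face_def by blast
    then have "?m \<bullet> b = ?m \<bullet> p k" "?m \<bullet> x = ?m \<bullet> p k"
      using face_vector_dot_face k x by blast+
    moreover have "?m \<bullet> x = u * (?m \<bullet> p j) + v * (?m \<bullet> b)"
      by (simp add: uv(3) inner_add_right)
    moreover have "?m \<bullet> p j = ?m \<bullet> p k + tetra_det p"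
      using face_vector_dot_diff[of p j j k] k by (simp add: inner_diff_right)
    ultimately have "(u + v - 1) * (?m \<bullet> p k) + u * tetra_det p = 0" by (simp add: algebra_simps)
    then have "u = 0" using d uv(1) by simp
    then show "x \<in> convex hull (p ` (- {i, j}))" using uv by simp
  qed
qed

lemma diameter_closed_segment:
  fixes a b :: "'a::euclidean_space"
  shows "diameter (closed_segment a b) = norm (a - b)"
proof (rule antisym)
  have "norm (x - y) \<le> norm (a - b)" if "x \<in> closed_segment a b" "y \<in> closed_segment a b" for x y
    using segment_furthest_le[OF that(2), of x] segment_bound[OF that(1)]
    by (auto simp: norm_minus_commute)
  then show "diameter (closed_segment a b) \<le> norm (a - b)" by (intro diameter_le) auto
  show "norm (a - b) \<le> diameter (closed_segment a b)"
    using diameter_bounded_bound[OF bounded_closed_segment, of a a b b] by (simp add: dist_norm)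
qed

text \<open>The geometric edge shared by two faces joins the vertices that carry the other two
  labels, and these are the ends of \<open>opposite_edge e\<close>.\<close>

lemma lengths_eq:
  assumes "tetra_det p \<noteq> 0"
  shows "lengths p $ e = norm (p (edge_fst (opposite_edge e)) - p (edge_snd (opposite_edge e)))"
proof -
  have "- {edge_fst e, edge_snd e} = {edge_fst (opposite_edge e), edge_snd (opposite_edge e)}"
    using edge_cases[of e] UNIV_label by (elim disjE) auto
  moreover have "edge_fst e \<noteq> edge_snd e" using edge_fst_less_snd[of e] by simp
  ultimately show ?thesis
    by (simp add: lengths_def edge_length_def face_Int_face[OF assms] segment_convex_hull[symmetric]
        diameter_closed_segment)
qed

section \<open>Volume and nondegeneracy\<close>

lemma tetra_volume_eq:
  assumes "inj p"
  shows "tetra_volume p = \<bar>tetra_det p\<bar> / 6"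
proof -
  define f :: "3 \<Rightarrow> real^3" where "f j = p (nonzero_label j)" for j
  have "measure lborel (convex hull (range p)) = \<bar>det (\<chi> i j. f j $ i - p 0 $ i)\<bar> / fact CARD(3)"
  proof (rule content_simplex)
    show "card (range p) = Suc CARD(3)" using assms by (simp add: card_image)
    show "bij_betw f UNIV (range p - {p 0})"
    proof (rule bij_betwI')
      fix x y :: 3 show "f x = f y \<longleftrightarrow> x = y"
        using assms exhaust_3[of x] exhaust_3[of y] by (auto simp: f_def inj_eq)
    next
      fix x :: 3 show "f x \<in> range p - {p 0}"
        using assms exhaust_3[of x] by (auto simp: f_def inj_eq)
    next
      fix y assume "y \<in> range p - {p 0}"
      then obtain i where "y = p i" "i \<noteq> 0" by auto
      then show "\<exists>x\<in>UNIV. y = f x"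
        using label_cases[of i] by (auto simp: f_def intro: exI[of _ 1] exI[of _ 2] exI[of _ 3])
    qed
  qed auto
  also have "det (\<chi> i j. f j $ i - p 0 $ i) = tetra_det p"
    by (simp add: f_def tetra_det_def cross3_simps)
  finally show ?thesis by (simp add: tetra_volume_def fact_numeral)
qed

text \<open>A linear relation among the differences \<open>p k - p 0\<close> becomes an affine
  relation among the vertices when \<open>p 0\<close> receives minus the sum of the
  coefficients.\<close>

lemma tetra_det_nonzero:
  assumes "nondegenerate p"
  shows "tetra_det p \<noteq> 0"
proof -
  have inj: "inj p" and indep: "\<not> affine_dependent (range p)"
    using assms by (auto simp: nondegenerate_def)
  define A :: "real^3^3" where "A = (\<chi> k. p (nonzero_label k) - p 0)"
  have "\<forall>c. (\<Sum>k\<in>UNIV. c k *s row k A) = 0 \<longrightarrow> (\<forall>k. c k = 0)"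
  proof (intro allI impI)
    fix c k assume c: "(\<Sum>k\<in>UNIV. c k *s row k A) = 0"
    define w where "w i = (if i = 0 then - (c 1 + c 2 + c 3) else if i = 1 then c 1 else if i = 2 then c 2 else c 3)" for i :: 4
    have "(\<Sum>v\<in>range p. w (inv p v)) = 0"
      by (simp add: sum.reindex[OF inj] inj sum_label w_def)
    moreover have "(\<Sum>v\<in>range p. w (inv p v) *\<^sub>R v) = 0"
    proof -
      have "(\<Sum>v\<in>range p. w (inv p v) *\<^sub>R v) = (\<Sum>k\<in>UNIV. c k *s row k A)"
        by (simp add: sum.reindex[OF inj] inj sum_label sum_3 w_def A_def row_def vec_eq_iff algebra_simps)
      then show ?thesis using c by simp
    qed
    ultimately have "\<forall>v\<in>range p. w (inv p v) = 0"
      using indep affine_dependent_explicit_finite[of "range p"] by auto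
    then have "w i = 0" for i using inj by auto
    from this[of 1] this[of 2] this[of 3] show "c k = 0"
      using exhaust_3[of k] by (auto simp: w_def)
  qed
  then have "invertible A"
    unfolding matrix_right_invertible_independent_rows[symmetric] invertible_right_inverse .
  then have "det A \<noteq> 0" by (simp add: invertible_det_nz)
  moreover have "det A = tetra_det p"
    by (simp add: A_def tetra_det_def cross3_simps)
  ultimately show ?thesis by simp
qed

section \<open>The Laplacian of the face vectors\<close>

definition face_gram :: "(4 \<Rightarrow> real^3) \<Rightarrow> edge \<Rightarrow> real" where
  "face_gram p e = face_vector p (edge_fst e) \<bullet> face_vector p (edge_snd e)"

lemma sum_face_vector: "face_vector p 0 + face_vector p 1 + face_vector p 2 + face_vector p 3 = 0"
  by (simp add: face_vector_simps)

text \<open>On the diagonal the claim says that the rows of the Gram matrix sum to 0, which holds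
  because the face vectors do.\<close>

lemma laplacian_face_gram: "laplacian (face_gram p) i j = face_vector p i \<bullet> face_vector p j"
proof -
  have off: "laplacian (face_gram p) i j = face_vector p i \<bullet> face_vector p j" if "i \<noteq> j" for i j
    using label_cases[of i] label_cases[of j] that
    by (elim disjE) (simp_all add: laplacian_off_diagonal face_gram_def inner_commute)
  show ?thesis
  proof (cases "i = j")
    case True
    have "face_vector p i \<bullet> (face_vector p 0 + face_vector p 1 + face_vector p 2 + face_vector p 3) = 0"
      by (simp add: sum_face_vector)
    then have "face_vector p i \<bullet> face_vector p 0 + face_vector p i \<bullet> face_vector p 1 + face_vector p i \<bullet> face_vector p 2 +
        face_vector p i \<bullet> face_vector p 3 = 0"
      by (simp add: inner_add_right)
    then show ?thesis
      using laplacian_row_sum[of "face_gram p" i] label_cases[of i] True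
      by (elim disjE) (simp_all add: off)
  qed (rule off)
qed

lemma det_gram_matrix:
  fixes v :: "'n::finite \<Rightarrow> real^'n"
  shows "det (\<chi> i j. v i \<bullet> v j) = (det (\<chi> i. v i))\<^sup>2"
proof -
  have "(\<chi> i j. v i \<bullet> v j) = (\<chi> i. v i) ** transpose (\<chi> i. v i)"
    by (simp add: vec_eq_iff matrix_matrix_mult_def transpose_def inner_vec_def)
  then show ?thesis by (simp add: det_mul power2_eq_square)
qed

lemma cross_cross_triple: "(a \<times> b) \<times> (b \<times> c) = (a \<bullet> (b \<times> c)) *\<^sub>R b"
  unfolding vec_eq_iff forall_3 by (simp add: cross3_simps)

lemma dot_cross_rotate: "a \<bullet> (b \<times> c) = b \<bullet> (c \<times> a)"
  by (simp add: cross3_simps)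

text \<open>The minor is the Gram determinant of three face vectors. These are the cross products of
  the edge vectors at \<open>p 0\<close>, whose triple product is the square of
  \<open>tetra_det p\<close>.\<close>

lemma tree_minor_face_gram: "tree_minor (face_gram p) = tetra_det p ^ 4"
proof -
  define u1 u2 u3 where u: "u1 = p 1 - p 0" "u2 = p 2 - p 0" "u3 = p 3 - p 0"
  have "tree_minor (face_gram p) = det (\<chi> i j :: 3. face_vector p (nonzero_label i) \<bullet> face_vector p (nonzero_label j))"
    by (simp add: tree_minor_def laplacian_face_gram nonzero_label_def[symmetric])
  also have "\<dots> = (det (\<chi> i. face_vector p (nonzero_label i)))\<^sup>2"
    by (rule det_gram_matrix)
  also have "det (\<chi> i. face_vector p (nonzero_label i)) = (u2 \<times> u3) \<bullet> ((u3 \<times> u1) \<times> (u1 \<times> u2))"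
    by (simp add: dot_cross_det face_vector_simps u[symmetric] vector_3 det_3)
  also have "(u3 \<times> u1) \<times> (u1 \<times> u2) = (u1 \<bullet> (u2 \<times> u3)) *\<^sub>R u1"
    by (simp add: cross_cross_triple dot_cross_rotate[of u3])
  also have "(u2 \<times> u3) \<bullet> \<dots> = (u1 \<bullet> (u2 \<times> u3))\<^sup>2"
    by (simp add: power2_eq_square inner_commute)
  finally show ?thesis by (simp add: tetra_det_def u)
qed

text \<open>The cross product of two face normals is parallel to the common edge. The sign depends
  on the orientation of the edge and disappears on taking norms.\<close>

lemma face_vector_cross:
  "\<exists>s\<in>{1, - 1}. face_vector p (edge_fst e) \<times> face_vector p (edge_snd e) =
     (s * tetra_det p) *\<^sub>R (p (edge_fst (opposite_edge e)) - p (edge_snd (opposite_edge e)))"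
proof -
  define u1 u2 u3 where u: "u1 = p 1 - p 0" "u2 = p 2 - p 0" "u3 = p 3 - p 0"
  define d where "d = u1 \<bullet> (u2 \<times> u3)"
  have d: "tetra_det p = d" by (simp add: tetra_det_def d_def u)
  have 12: "(u2 \<times> u3) \<times> (u3 \<times> u1) = d *\<^sub>R u3" and 23: "(u3 \<times> u1) \<times> (u1 \<times> u2) = d *\<^sub>R u1"
    and 31: "(u1 \<times> u2) \<times> (u2 \<times> u3) = d *\<^sub>R u2"
    unfolding d_def by (simp_all add: cross_cross_triple dot_cross_rotate[of u3] dot_cross_rotate[of u1])
  note m = face_vector_simps[of p, folded u]
  have edges: "p 2 - p 3 = u2 - u3" "p 1 - p 3 = u1 - u3" "p 1 - p 2 = u1 - u2" "p 0 - p 3 = - u3"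
    "p 0 - p 2 = - u2" "p 0 - p 1 = - u1"
    by (simp_all add: u)
  have swap: "(u3 \<times> u1) \<times> (u2 \<times> u3) = - d *\<^sub>R u3" "(u1 \<times> u2) \<times> (u3 \<times> u1) = - d *\<^sub>R u1"
    "(u2 \<times> u3) \<times> (u1 \<times> u2) = - d *\<^sub>R u2"
    using 12 23 31 cross_skew by (metis scaleR_minus_left)+
  show ?thesis
    using edge_cases[of e]
    by (elim disjE; simp add: m d edges Cross3.left_diff_distrib cross_minus_left 12 23 31 swap
      scaleR_diff_right)
qed

text \<open>By Lagrange's identity the minor is the squared norm of the cross product of the two
  face vectors.\<close>

lemma edge_minor_face_gram:
  assumes "tetra_det p \<noteq> 0"
  shows "edge_minor (face_gram p) e = (tetra_det p * lengths p $ e)\<^sup>2"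
proof -
  let ?m = "face_vector p (edge_fst e)" and ?n = "face_vector p (edge_snd e)"
  have "edge_minor (face_gram p) e = (norm ?m)\<^sup>2 * (norm ?n)\<^sup>2 - (?m \<bullet> ?n)\<^sup>2"
    by (simp add: edge_minor_def laplacian_face_gram face_gram_def power2_norm_eq_inner)
  also have "\<dots> = (norm (?m \<times> ?n))\<^sup>2" by (simp add: norm_cross)
  also have "norm (?m \<times> ?n) = \<bar>tetra_det p * lengths p $ e\<bar>"
    using face_vector_cross[of p e] by (auto simp: lengths_eq[OF assms] abs_mult)
  finally show ?thesis by simp
qed

lemma lengths_pos:
  assumes "nondegenerate p"
  shows "lengths p $ e > 0"
proof -
  have "inj p" using assms by (simp add: nondegenerate_def)
  then show ?thesis
    using edge_fst_less_snd[of "opposite_edge e"] by (auto simp: lengths_eq[OF tetra_det_nonzero[OF assms]] inj_eq)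
qed

lemma face_vector_nonzero:
  assumes "tetra_det p \<noteq> 0"
  shows "face_vector p i \<noteq> 0"
  using face_vector_dot_diff[of p i i "i + 1"] assms by auto

text \<open>Scaling rows and columns by \<open>s\<close> multiplies the determinant by the product
  of all \<open>(s i)\<^sup>2\<close> and the entry at \<open>e\<close> by the two factors at its
  ends, so the derivative gains the quotient.\<close>

lemma det_deriv_scale:
  assumes "\<And>i j. C i j = C' i j * s i * (s j :: real)"
  shows "det_deriv C e * (s (edge_fst e) * s (edge_snd e)) = det_deriv C' e * (\<Prod>i\<in>UNIV. (s i)\<^sup>2)"
  using edge_cases[of e]
  by (elim disjE) (simp_all add: det_deriv_def Let_def assms prod_label power2_eq_square algebra_simps)

lemma det_deriv2_scale:
  assumes "\<And>i j. C i j = C' i j * s i * (s j :: real)"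
  shows "det_deriv2 C e f * (s (edge_fst e) * s (edge_snd e)) * (s (edge_fst f) * s (edge_snd f))
    = det_deriv2 C' e f * (\<Prod>i\<in>UNIV. (s i)\<^sup>2)"
  using edge_cases[of e] edge_cases[of f]
  by (elim disjE) (simp_all add: det_deriv2_def shared_label_def Let_def assms prod_label power2_eq_square algebra_simps)

lemma det_symmetric_scale:
  fixes A :: "4 \<Rightarrow> 4 \<Rightarrow> real"
  shows "det (\<chi> i j. A i j * s i * s j) = det (\<chi> i j. A i j) * (\<Prod>i\<in>UNIV. (s i)\<^sup>2)"
  by (simp add: det_4 prod_label power2_eq_square algebra_simps)

lemma det_laplacian: "det (\<chi> i j. laplacian a i j) = 0"
  by (simp add: det_4 laplacian_off_diagonal laplacian_diagonal algebra_simps)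

text \<open>The sign of \<open>tetra_det p\<close> occurs in both outward normals and cancels in
  their inner product, so the angle cosine is that of the two face vectors.\<close>

lemma gram_entry_angles:
  assumes "tetra_det p \<noteq> 0"
  shows "laplacian (face_gram p) i j = gram_entry (angles p) i j * norm (face_vector p i) * norm (face_vector p j)"
proof -
  let ?m = "face_vector p"
  have nz: "norm (?m i) > 0" for i using face_vector_nonzero[OF assms] by simp
  have dot: "outward_normal p i \<bullet> outward_normal p j = (?m i \<bullet> ?m j) / (norm (?m i) * norm (?m j))" for i j
    using assms by (simp add: outward_normal_eq[OF assms] sgn_if)
  have cos: "cos (dihedral_angle p i j) = (?m i \<bullet> ?m j) / (norm (?m i) * norm (?m j))" for i j
  proof -
    have "\<bar>(?m i \<bullet> ?m j) / (norm (?m i) * norm (?m j))\<bar> \<le> 1"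
      using Cauchy_Schwarz_ineq2[of "?m i" "?m j"] nz[of i] nz[of j] by (simp add: abs_mult divide_le_eq)
    then show ?thesis by (simp add: dihedral_angle_def dot cos_arccos_abs)
  qed
  show ?thesis
  proof (cases "i = j")
    case True
    then show ?thesis by (simp add: gram_entry_simps laplacian_face_gram power2_norm_eq_inner[symmetric] power2_eq_square)
  next
    case False
    have "edge_fst (edge_between i j) = i \<and> edge_snd (edge_between i j) = j \<or>
      edge_fst (edge_between i j) = j \<and> edge_snd (edge_between i j) = i"
      using False by (metis edge_between_sym edge_endpoints linorder_neqE)
    then have "cos (angles p $ edge_between i j) = (?m i \<bullet> ?m j) / (norm (?m i) * norm (?m j))"
      by (auto simp: angles_def cos inner_commute mult.commute)
    with False show ?thesis using nz[of i] nz[of j] by (simp add: gram_entry_simps laplacian_face_gram)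
  qed
qed

text \<open>The sine comes from \<open>1 - x\<^sup>2\<close>, which is
  \<open>edge_minor (face_gram p) e\<close> divided by the squared product of the two norms; that
  minor is the square of \<open>tetra_det p * lengths p $ e\<close>.\<close>

lemma cos_sin_angles:
  assumes "nondegenerate p"
  defines "s e \<equiv> norm (face_vector p (edge_fst e)) * norm (face_vector p (edge_snd e))"
  shows "cos (angles p $ e) = face_gram p e / s e"
    and "sin (angles p $ e) = \<bar>tetra_det p\<bar> * lengths p $ e / s e"
proof -
  let ?m = "face_vector p (edge_fst e)" and ?n = "face_vector p (edge_snd e)"
  have d: "tetra_det p \<noteq> 0" by (rule tetra_det_nonzero[OF assms(1)])
  have s: "s e > 0" using face_vector_nonzero[OF d] by (simp add: s_def)
  have "edge_fst e \<noteq> edge_snd e" using edge_fst_less_snd[of e] by simp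
  then have "face_gram p e = cos (angles p $ e) * s e"
    using gram_entry_angles[OF d, of "edge_fst e" "edge_snd e"]
    by (simp add: gram_entry_simps laplacian_off_diagonal edge_between_endpoints s_def)
  then show "cos (angles p $ e) = face_gram p e / s e" using s by simp
  define x where "x = outward_normal p (edge_fst e) \<bullet> outward_normal p (edge_snd e)"
  have x: "x = face_gram p e / s e"
    using d by (simp add: x_def outward_normal_eq[OF d] sgn_if face_gram_def s_def)
  have minor: "(s e)\<^sup>2 - (face_gram p e)\<^sup>2 = (tetra_det p * lengths p $ e)\<^sup>2"
    unfolding edge_minor_face_gram[OF d, symmetric] edge_minor_def
    by (simp add: laplacian_face_gram s_def power_mult_distrib power2_norm_eq_inner)
  have "1 - x\<^sup>2 = ((s e)\<^sup>2 - (face_gram p e)\<^sup>2) / (s e)\<^sup>2"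
    using s by (simp add: x power_divide diff_divide_distrib)
  then have x2: "1 - x\<^sup>2 = (\<bar>tetra_det p\<bar> * lengths p $ e / s e)\<^sup>2"
    unfolding minor by (simp add: power_divide power_mult_distrib)
  then have "x\<^sup>2 \<le> 1" by (smt (verit) zero_le_power2)
  then have "\<bar>x\<bar> \<le> 1" by (simp add: abs_square_le_1)
  then have "sin (angles p $ e) = sqrt (1 - x\<^sup>2)"
    by (simp add: angles_def dihedral_angle_def x_def[symmetric] sin_arccos_abs)
  also have "\<dots> = \<bar>tetra_det p\<bar> * lengths p $ e / s e"
    unfolding x2 using s lengths_pos[OF assms(1), of e] by simp
  finally show "sin (angles p $ e) = \<bar>tetra_det p\<bar> * lengths p $ e / s e" .
qed

section \<open>The Hessian of the action\<close>

lemma det_of_real: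
  fixes A :: "real^'n^'n"
  shows "det (\<chi> i j. complex_of_real (A $ i $ j)) = complex_of_real (det A)"
  by (simp add: det_def)

lemma det_scale_matrix:
  fixes A :: "'a::comm_ring_1^'n^'n"
  shows "det (\<chi> i j. c * A $ i $ j) = c ^ CARD('n) * det A"
proof -
  have "(\<chi> i j. c * A $ i $ j) = (\<chi> i. c *s A $ i)" by (simp add: vec_eq_iff)
  then show ?thesis by (simp add: det_rows_mul)
qed

lemma det_minus_matrix_inv:
  fixes A :: "'a::field^'n^'n"
  assumes "invertible A"
  shows "det (- matrix_inv A) = (- 1) ^ CARD('n) / det A"
proof -
  have "\<exists>B. A ** B = mat 1 \<and> B ** A = mat 1"
    using assms by (simp add: invertible_def)
  then have "A ** matrix_inv A = mat 1"
    unfolding matrix_inv_def by (rule someI2_ex) simp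
  then have "det A * det (matrix_inv A) = 1"
    by (metis det_I det_mul)
  moreover have "det A \<noteq> 0"
    using assms by (simp add: invertible_det_nz)
  ultimately have "det (matrix_inv A) = 1 / det A"
    by (simp add: eq_divide_eq mult.commute)
  moreover have "- matrix_inv A = (\<chi> i j. - 1 * matrix_inv A $ i $ j)"
    by (simp add: vec_eq_iff)
  ultimately show ?thesis
    by (simp only: det_scale_matrix) simp
qed

lemma card_edge_option: "CARD(edge option) = 7"
proof -
  have "CARD(edge) = 6" unfolding UNIV_edge by simp
  then show ?thesis by (simp add: card_UNIV_option)
qed

unbundle no cross3_syntax

section \<open>Evaluation at the dihedral angles of a tetrahedron\<close>

context
  fixes p :: "4 \<Rightarrow> real^3" and d L P :: real
  assumes nondeg: "nondegenerate p"
  defines "d \<equiv> \<bar>tetra_det p\<bar>" and "L \<equiv> norm (lengths p)"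
    and "P \<equiv> \<Prod>i\<in>UNIV. (norm (face_vector p i))\<^sup>2"
begin

lemma abs_tetra_det_pos: "d > 0"
  using tetra_det_nonzero[OF nondeg] by (simp add: d_def)

lemma norm_lengths_pos: "L > 0"
  using lengths_pos[OF nondeg] unfolding L_def by (metis less_irrefl zero_index zero_less_norm_iff)

lemma areas_pos: "P > 0"
  using face_vector_nonzero[OF tetra_det_nonzero[OF nondeg]] unfolding P_def by (intro prod_pos) auto

lemma prod_face_area: "(\<Prod>i\<in>UNIV. (face_area p i)\<^sup>2) = P / 2 ^ 8"
  by (simp add: P_def norm_face_vector prod_label power_mult_distrib)

lemma volume_eq: "tetra_volume p = d / 6"
  using tetra_volume_eq[of p] nondeg by (simp add: d_def nondegenerate_def)

text \<open>With \<open>d\<close> six times the volume, the powers of 3 cancel and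
  \<open>2^2 * 2^5 / 2^8 = 1/2\<close> remains.\<close>

lemma rho_eq: "rho p = - P / (2 * d ^ 5 * L)"
  using abs_tetra_det_pos norm_lengths_pos unfolding rho_def prod_face_area volume_eq L_def[symmetric]
  by (simp add: power_divide)

lemma tree_minor_eq: "tree_minor (face_gram p) = d ^ 4"
  by (simp add: tree_minor_face_gram d_def)

text \<open>Up to positive row and column factors the Gram matrix is a Laplacian, which is
  singular.\<close>

lemma det_gram_angles: "det_gram (angles p) = 0"
proof -
  have "det (\<chi> i j. laplacian (face_gram p) i j) = det_gram (angles p) * P"
    unfolding gram_entry_angles[OF tetra_det_nonzero[OF nondeg]] det_symmetric_scale P_def
    by (simp add: det_gram_def gram_entry_def)
  then show ?thesis using areas_pos by (simp add: det_laplacian)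
qed

text \<open>The norms of the two face vectors cancel between the sine and the rescaled cofactor. The
  gradient is thus proportional to the edge lengths, which is what makes the point
  stationary.\<close>

lemma partial_det_gram_angles: "partial e det_gram (angles p) = - 2 * d ^ 5 / P * lengths p $ e"
proof -
  define s where "s = norm (face_vector p (edge_fst e)) * norm (face_vector p (edge_snd e))"
  have s: "s > 0" using face_vector_nonzero[OF tetra_det_nonzero[OF nondeg]] by (simp add: s_def)
  have "2 * d ^ 4 * s = det_deriv (gram_entry (angles p)) e * P"
    using det_deriv_scale[where e = e and s = "\<lambda>i. norm (face_vector p i)",
        OF gram_entry_angles[OF tetra_det_nonzero[OF nondeg]]]
    by (simp add: det_deriv_laplacian tree_minor_eq s_def P_def)
  then have "det_deriv (gram_entry (angles p)) e = 2 * d ^ 4 * s / P"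
    using areas_pos by (simp add: field_simps)
  moreover have "sin (angles p $ e) = d * lengths p $ e / s"
    using cos_sin_angles(2)[OF nondeg] by (simp add: s_def d_def)
  ultimately show ?thesis using s areas_pos by (simp add: partial_det_gram power_def numeral_eq_Suc)
qed

lemma partial_partial_det_gram_angles:
  "partial e (partial f det_gram) (angles p) = d\<^sup>2 / P * lengths p $ e * lengths p $ f *
    (det_deriv2 (laplacian (face_gram p)) e f -
      (if e = f then 2 * tree_minor (face_gram p) * face_gram p e / edge_minor (face_gram p) e else 0))"
proof -
  define s where "s e = norm (face_vector p (edge_fst e)) * norm (face_vector p (edge_snd e))" for e
  define l where "l e = lengths p $ e" for e
  have s: "s e > 0" for e using face_vector_nonzero[OF tetra_det_nonzero[OF nondeg]] by (simp add: s_def)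
  have l: "l e > 0" for e using lengths_pos[OF nondeg] by (simp add: l_def)
  have "det_deriv2 (laplacian (face_gram p)) e f * s e * s f = det_deriv2 (gram_entry (angles p)) e f * P"
    using det_deriv2_scale[where e = e and f = f and s = "\<lambda>i. norm (face_vector p i)",
        OF gram_entry_angles[OF tetra_det_nonzero[OF nondeg]]]
    by (simp add: s_def P_def)
  then have D2: "det_deriv2 (gram_entry (angles p)) e f = det_deriv2 (laplacian (face_gram p)) e f * s e * s f / P"
    using areas_pos by (simp add: field_simps)
  have "2 * d ^ 4 * s e = det_deriv (gram_entry (angles p)) e * P"
    using det_deriv_scale[where e = e and s = "\<lambda>i. norm (face_vector p i)",
        OF gram_entry_angles[OF tetra_det_nonzero[OF nondeg]]]
    by (simp add: det_deriv_laplacian tree_minor_eq s_def P_def)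
  then have D: "det_deriv (gram_entry (angles p)) e = 2 * d ^ 4 * s e / P"
    using areas_pos by (simp add: field_simps)
  have sin: "sin (angles p $ e) = d * l e / s e" for e
    using cos_sin_angles(2)[OF nondeg] by (simp add: s_def d_def l_def)
  have cos: "cos (angles p $ e) = face_gram p e / s e"
    using cos_sin_angles(1)[OF nondeg] by (simp add: s_def)
  have minor: "edge_minor (face_gram p) e = d\<^sup>2 * (l e)\<^sup>2"
    by (simp add: edge_minor_face_gram[OF tetra_det_nonzero[OF nondeg]] d_def l_def power_mult_distrib)
  show ?thesis
  proof (cases "e = f")
    case True
    have "partial e (partial f det_gram) (angles p) =
        d\<^sup>2 / P * l e * l e * det_deriv2 (laplacian (face_gram p)) e e - 2 * d ^ 4 * face_gram p e / P"
      using True s[of e] D2 unfolding partial_partial_det_gram D sin cos by (simp add: power2_eq_square mult_ac)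
    \<comment> \<open>The cosine term is brought under the common factor by dividing by
      \<open>d\<^sup>2 * (l e)\<^sup>2\<close>, which is the edge minor.\<close>
    also have "\<dots> = d\<^sup>2 / P * l e * l e * (det_deriv2 (laplacian (face_gram p)) e e -
        2 * d ^ 4 * face_gram p e / (d\<^sup>2 * (l e)\<^sup>2))"
      using l[of e] abs_tetra_det_pos areas_pos by (simp add: right_diff_distrib power2_eq_square)
    finally show ?thesis using True minor by (simp add: tree_minor_eq l_def)
  next
    case False
    then show ?thesis
      using s[of e] s[of f] unfolding partial_partial_det_gram D2 sin by (simp add: l_def power2_eq_square)
  qed
qed

lemma H_matrix_eq:
  "H_matrix p = (\<chi> a b. - \<i> * complex_of_real L * complex_of_real (bordered_matrix
    (\<lambda>e. - 2 * d ^ 5 / P * lengths p $ e)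
    (\<lambda>e f. rho p * d\<^sup>2 / P * lengths p $ e * lengths p $ f * (det_deriv2 (laplacian (face_gram p)) e f -
      (if e = f then 2 * tree_minor (face_gram p) * face_gram p e / edge_minor (face_gram p) e else 0))) $ a $ b))"
proof -
  have "rho p * partial e (partial f det_gram) (angles p) =
    rho p * d\<^sup>2 / P * lengths p $ e * lengths p $ f * (det_deriv2 (laplacian (face_gram p)) e f -
      (if e = f then 2 * tree_minor (face_gram p) * face_gram p e / edge_minor (face_gram p) e else 0))" for e f
    unfolding partial_partial_det_gram_angles by simp
  then show ?thesis
    unfolding H_matrix_def partial_det_gram_angles L_def[symmetric] bordered_matrix_def
    by (simp only: vec_eq_iff vec_lambda_beta) (simp split: option.split)
qed

lemma det_H_matrix: "det (H_matrix p) = - 4 * \<i> * complex_of_real (d ^ 7 * L\<^sup>2 / P)"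
proof -
  let ?\<gamma> = "- 2 * d ^ 5 / P" and ?\<kappa> = "rho p * d\<^sup>2 / P"
  define M where "M = bordered_matrix (\<lambda>e. ?\<gamma> * lengths p $ e)
    (\<lambda>e f. ?\<kappa> * lengths p $ e * lengths p $ f * (det_deriv2 (laplacian (face_gram p)) e f -
      (if e = f then 2 * tree_minor (face_gram p) * face_gram p e / edge_minor (face_gram p) e else 0)))"
  define l where "l = (\<Prod>e\<in>UNIV. lengths p $ e)"
  have l: "l > 0" unfolding l_def by (intro prod_pos) (simp add: lengths_pos[OF nondeg])
  have minor: "edge_minor (face_gram p) e = d\<^sup>2 * (lengths p $ e)\<^sup>2" for e
    by (simp add: edge_minor_face_gram[OF tetra_det_nonzero[OF nondeg]] d_def power_mult_distrib)
  have \<kappa>: "?\<kappa> = - 1 / (2 * d ^ 3 * L)"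
    using abs_tetra_det_pos norm_lengths_pos areas_pos by (simp add: rho_eq power_def numeral_eq_Suc)
  have prod_minor: "(\<Prod>e\<in>UNIV. edge_minor (face_gram p) e) = d ^ 12 * l\<^sup>2"
  proof -
    have "(\<Prod>e\<in>UNIV. edge_minor (face_gram p) e) = (\<Prod>e\<in>(UNIV::edge set). d\<^sup>2) * l\<^sup>2"
      by (simp only: minor prod.distrib l_def prod_power_distrib)
    also have "(\<Prod>e\<in>(UNIV::edge set). d\<^sup>2) = d ^ 12"
      unfolding prod_edge by (simp add: power_def numeral_eq_Suc)
    finally show ?thesis .
  qed
  have "det M * (\<Prod>e\<in>UNIV. edge_minor (face_gram p) e) = 32 * ?\<gamma>\<^sup>2 * ?\<kappa>^5 * tree_minor (face_gram p) ^ 6 *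
      (\<Prod>e\<in>UNIV. lengths p $ e)\<^sup>2 * (\<Prod>i\<in>UNIV. laplacian (face_gram p) i i)"
    unfolding M_def
  proof (rule det_bordered_hessian)
    show "edge_minor (face_gram p) e \<noteq> 0" for e
      using abs_tetra_det_pos lengths_pos[OF nondeg, of e] by (simp add: minor)
    show "tree_minor (face_gram p) \<noteq> 0" using abs_tetra_det_pos by (simp add: tree_minor_eq)
    show "?\<kappa> \<noteq> 0" unfolding \<kappa> using abs_tetra_det_pos norm_lengths_pos by simp
  qed
  also have "(\<Prod>i\<in>UNIV. laplacian (face_gram p) i i) = P"
    by (simp add: laplacian_face_gram P_def power2_norm_eq_inner)
  finally have "det M * (d ^ 12 * l\<^sup>2) = 32 * ?\<gamma>\<^sup>2 * (- 1 / (2 * d ^ 3 * L)) ^ 5 * (d ^ 4) ^ 6 * l\<^sup>2 * P"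
    by (simp only: prod_minor \<kappa> tree_minor_eq l_def)
  also have "\<dots> = (- 4 * d ^ 7 / (P * L ^ 5)) * (d ^ 12 * l\<^sup>2)"
    using abs_tetra_det_pos norm_lengths_pos areas_pos
    by (simp add: power_divide divide_simps) (simp add: power_def numeral_eq_Suc)
  finally have detM: "det M = - 4 * d ^ 7 / (P * L ^ 5)"
  proof (rule mult_right_cancel[THEN iffD1, rotated])
    show "d ^ 12 * l\<^sup>2 \<noteq> 0" using abs_tetra_det_pos l by simp
  qed
  define c where "c = - \<i> * complex_of_real L"
  have "det (H_matrix p) = det (\<chi> a b. c * (\<chi> a b. complex_of_real (M $ a $ b)) $ a $ b)"
    unfolding H_matrix_eq M_def c_def by simp
  \<comment> \<open>Each of the seven rows carries the scalar prefactor of the Hessian.\<close>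
  also have "\<dots> = c ^ 7 * complex_of_real (det M)"
    unfolding det_scale_matrix card_edge_option det_of_real ..
  also have "c ^ 7 = \<i> * complex_of_real (L ^ 7)"
  proof -
    have "(- \<i>) ^ 7 = \<i>" by (simp add: power_def numeral_eq_Suc)
    then show ?thesis unfolding c_def power_mult_distrib by simp
  qed
  also have "\<i> * complex_of_real (L ^ 7) * complex_of_real (det M) = \<i> * complex_of_real (L ^ 7 * det M)"
    by simp
  also have "L ^ 7 * det M = - 4 * (d ^ 7 * L\<^sup>2 / P)"
    unfolding detM using norm_lengths_pos by (simp add: divide_simps)
  finally show ?thesis by simp
qed

end

theorem mainTheorem4:
  fixes p :: "4 \<Rightarrow> real^3"
  assumes "nondegenerate p"
  shows "(\<forall>a. partial a (action p) (stationary_point p) = 0) \<and>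
    H_matrix p = (\<chi> a b. partial a (partial b (action p)) (stationary_point p)) \<and>
    invertible (H_matrix p) \<and>
    det (- matrix_inv (H_matrix p)) =
      - \<i> * (1 / (2 * 3^7)) *
        complex_of_real ((\<Prod>i\<in>UNIV. (face_area p i)^2) / ((norm (lengths p))^2 * (tetra_volume p)^7))"
proof (intro conjI allI)
  define d where "d = \<bar>tetra_det p\<bar>"
  define L where "L = norm (lengths p)"
  define P where "P = (\<Prod>i\<in>UNIV. (norm (face_vector p i))\<^sup>2)"
  have pos: "d > 0" "L > 0" "P > 0"
    using abs_tetra_det_pos[OF assms] norm_lengths_pos[OF assms] areas_pos[OF assms] by (simp_all add: d_def L_def P_def)
  show "partial a (action p) (stationary_point p) = 0" for a
  proof (cases a)
    case None
    then show ?thesis by (simp add: partial_action_None det_gram_angles[OF assms])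
  next
    case (Some e)
    \<comment> \<open>The value of \<open>\<rho>\<close> is exactly the one that cancels the
      constant in the gradient.\<close>
    have "norm (lengths p) * rho p * partial e det_gram (angles p) = lengths p $ e"
      using pos unfolding rho_eq[OF assms] partial_det_gram_angles[OF assms] d_def[symmetric] L_def[symmetric] P_def[symmetric]
      by simp
    then show ?thesis
      using Some by (simp only: partial_action_Some stationary_point_simps) simp
  qed
  show "H_matrix p = (\<chi> a b. partial a (partial b (action p)) (stationary_point p))"
    by (simp add: vec_eq_iff partial_partial_action)
  have det: "det (H_matrix p) = - 4 * \<i> * complex_of_real (d ^ 7 * L\<^sup>2 / P)"
    unfolding d_def L_def P_def by (rule det_H_matrix[OF assms])
  then show inv: "invertible (H_matrix p)"
    using pos by (simp add: invertible_det_nz)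
  have "det (- matrix_inv (H_matrix p)) = - 1 / det (H_matrix p)"
    unfolding det_minus_matrix_inv[OF inv] card_edge_option by simp
  also have "\<dots> = - \<i> * complex_of_real (P / (4 * d ^ 7 * L\<^sup>2))"
    unfolding det using pos by (simp add: field_simps)
  \<comment> \<open>Here \<open>P\<close> is \<open>2^8\<close> times the product of the squared
    areas and \<open>d\<close> is six times the volume, so the constant is
    \<open>2^8 / (4 * 6^7)\<close>.\<close>
  also have "P / (4 * d ^ 7 * L\<^sup>2) = 1 / (2 * 3^7) * ((P / 2 ^ 8) / (L\<^sup>2 * (d / 6) ^ 7))"
    using pos by (simp add: power_divide)
  finally show "det (- matrix_inv (H_matrix p)) = - \<i> * (1 / (2 * 3^7)) *
        complex_of_real ((\<Prod>i\<in>UNIV. (face_area p i)^2) / ((norm (lengths p))^2 * (tetra_volume p)^7))"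
    unfolding prod_face_area[OF assms] volume_eq[OF assms] d_def[symmetric] L_def[symmetric] P_def[symmetric]
    by simp
qed

end
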